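(* A necessary and sufficient condition for the existence of a unique stationary solution in $\mathbb{L}^1$ of the equation $$\underline{Y}_t=A(\underline{\eta}_t)\underline{Y}_{t-1}+\underline{B}(\underline{\eta}_t),\qquad t\in\mathbb{Z},$$ is that $$\rho\left(\prod_{v=0}^{s-1}\phi_{s-v}\right)<1 .$$ Moreover, this stationary solution is causal and ergodic.
   Context: Model. Fix integers $s,p,q\ge 1$ and put $d=p+q$. The periodic GARCH (PGARCH) process $(x_t)_{t\in\mathbb{Z}}$ of period $s$ satisfies, for $t\in\mathbb{Z}$ and $v=1,\dots,s$, $x_{st+v}=\varepsilon_{st+v}\sqrt{h_{st+v}}$ and $h_{st+v}=\alpha_0(v)+\sum_{i=1}^p\alpha_i(v)x_{st+v-i}^2+\sum_{j=1}^q\beta_j(v)h_{st+v-j}$, where $\alpha_0(v)>0$, $\alpha_i(v)\ge 0$, $\beta_j(v)\ge 0$ are constants. The $(\varepsilon_t)_{t\in\mathbb{Z}}$ are i.i.d. real random variables with $E\varepsilon_t=E\varepsilon_t^3=0$ and $E\varepsilon_t^2=1$; $\varepsilon_k$ is independent of $x_t$ for $k>t$. Vector form. Put $y_t=x_t^2$, $\eta_t=\varepsilon_t^2$, $\underline{\eta}_t=(\eta_{st+1},\dots,\eta_{st+s})'\in\mathbb{R}^s$ (an i.i.d. sequence), $\underline{y}_{st+v}=(y_{st+v},\dots,y_{st+v-p+1},h_{st+v},\dots,h_{st+v-q+1})'\in\mathbb{R}^d$ and $\underline{Y}_t=(\underline{y}_{st+1}',\dots,\underline{y}_{st+s}')'\in\mathbb{R}^{ds}$.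 Since $\underline{Y}_t$ is made of squares $x^2$ and volatilities $h$, solutions $(\underline{Y}_t)$ of the equation are understood to have nonnegative components. For $v=1,\dots,s$, $\underline{B}_v(\underline{\eta}_t)\in\mathbb{R}^d$ has first coordinate $\alpha_0(v)\eta_{st+v}$, $(p+1)$-th coordinate $\alpha_0(v)$, and all other coordinates $0$; and $\phi_v(\underline{\eta}_t)$ is the $d\times d$ matrix $$\phi_v(\underline{\eta}_t)=\begin{pmatrix} A_v(\underline{\eta}_t) & B_v(\underline{\eta}_t) \\ A_v & B_v \end{pmatrix},$$ where: $A_v(\underline{\eta}_t)$ is the $p\times p$ matrix with first row $(\alpha_1(v)\eta_{st+v},\dots,\alpha_p(v)\eta_{st+v})$, ones on the first subdiagonal and zeros elsewhere; $B_v(\underline{\eta}_t)$ is the $p\times q$ matrix with first row $(\beta_1(v)\eta_{st+v},\dots,\beta_q(v)\eta_{st+v})$ and zeros elsewhere; $A_v$ is the $q\times p$ matrix with first row $(\alpha_1(v),\dots,\alpha_p(v))$ and zeros elsewhere; $B_v$ is the $q\times q$ matrix with first row $(\beta_1(v),\dots,\beta_q(v))$, ones on the first subdiagonal and zeros elsewhere. The matrix $\phi_v$ (without argument) is the expectation $E\{\phi_v(\underline{\eta}_t)\}$, i.e. $\phi_v(\underline{\eta}_t)$ with every $\eta$ replaced by $1$. Products $\prod_{j=a}^{b}M_j$ of matrices are ordered $M_aM_{a+1}\cdots M_b$, so $\prod_{v=0}^{s-1}\phi_{s-v}=\phi_s\phi_{s-1}\cdots\phi_1$; empty products are identity matrices.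 $\rho(\cdot)$ is the spectral radius. $A(\underline{\eta}_t)$ is the $ds\times ds$ matrix, in $d\times d$ blocks, whose first $s-1$ block columns are zero and whose last block column has $v$-th block $\phi_v(\underline{\eta}_t)\cdots\phi_1(\underline{\eta}_t)$, $v=1,\dots,s$. $\underline{B}(\underline{\eta}_t)\in\mathbb{R}^{ds}$ has $v$-th block $\sum_{k=1}^{v}\{\prod_{i=0}^{v-k-1}\phi_{v-i}(\underline{\eta}_t)\}\underline{B}_k(\underline{\eta}_t)$, $v=1,\dots,s$. A stationary solution in $\mathbb{L}^1$ is a strictly stationary solution with $E\|\underline{Y}_t\|<\infty$. Causal means that $\underline{Y}_t$ is a measurable function of $\underline{\eta}_t,\underline{\eta}_{t-1},\dots$. *)

theory Defs
  imports
    "HOL-Probability.Probability"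
    "Jordan_Normal_Form.Spectral_Radius"
begin

unbundle no vec_syntax

text \<open>
  Vectors and matrices have sizes depending on \<open>s\<close>, \<open>p\<close>, \<open>q\<close>, so they are taken from
  \<open>Jordan_Normal_Form\<close>, whose entries are indexed from 0. The coefficients keep their one-based
  indices: \<open>alpha i v\<close> and \<open>beta j v\<close> are $\alpha_i(v)$, $\beta_j(v)$ with
  \<open>v \<in> {1..s}\<close>, \<open>i \<in> {0..p}\<close>, \<open>j \<in> {1..q}\<close>.
\<close>

text \<open>The Borel sets of $\mathbb{R}^n$, transported to the vectors of dimension \<open>n\<close>.\<close>

definition vec_borel :: "nat \<Rightarrow> real Matrix.vec measure" where
  "vec_borel n =
     vimage_algebra (carrier_vec n) (\<lambda>v. \<lambda>i\<in>{..<n}. v $ i) (Pi\<^sub>M {..<n} (\<lambda>_. borel))"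

lemma space_vec_borel [simp]: "space (vec_borel n) = carrier_vec n"
  by (simp add: vec_borel_def)

definition vec_norm :: "real Matrix.vec \<Rightarrow> real" where
  "vec_norm v = L2_set (\<lambda>i. v $ i) {..<dim_vec v}"

definition mean_mat :: "'a measure \<Rightarrow> nat \<Rightarrow> nat \<Rightarrow> ('a \<Rightarrow> real mat) \<Rightarrow> real mat" where
  "mean_mat M m n X = Matrix.mat m n (\<lambda>ij. \<integral>\<omega>. X \<omega> $$ ij \<partial>M)"

definition strictly_stationary :: "'a measure \<Rightarrow> 'b measure \<Rightarrow> (int \<Rightarrow> 'a \<Rightarrow> 'b) \<Rightarrow> bool" where
  "strictly_stationary M N X \<longleftrightarrow>
     (\<forall>h. distr M (Pi\<^sub>M UNIV (\<lambda>_. N)) (\<lambda>\<omega> t. X (t + h) \<omega>)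
        = distr M (Pi\<^sub>M UNIV (\<lambda>_. N)) (\<lambda>\<omega> t. X t \<omega>))"

text \<open>A stationary process is ergodic if the shift-invariant events of its path space have
  probability 0 or 1.\<close>

definition ergodic_process :: "'a measure \<Rightarrow> 'b measure \<Rightarrow> (int \<Rightarrow> 'a \<Rightarrow> 'b) \<Rightarrow> bool" where
  "ergodic_process M N X \<longleftrightarrow> strictly_stationary M N X \<and>
     (\<forall>S \<in> sets (Pi\<^sub>M UNIV (\<lambda>_. N)).
        (\<lambda>y t. y (t + 1)) -` S \<inter> space (Pi\<^sub>M UNIV (\<lambda>_. N)) = S \<longrightarrow>
        measure M {\<omega> \<in> space M. (\<lambda>t. X t \<omega>) \<in> S} \<in> {0, 1})"

text \<open>\<open>mat_prod n F m\<close> is the ordered product \<open>F 0 * F 1 * \<dots> * F (m - 1)\<close> of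
  \<open>n \<times> n\<close> matrices.\<close>

definition mat_prod :: "nat \<Rightarrow> (nat \<Rightarrow> real mat) \<Rightarrow> nat \<Rightarrow> real mat" where
  "mat_prod n F m = foldr (\<lambda>i P. F i * P) [0..<m] (1\<^sub>m n)"

definition eta_vec :: "nat \<Rightarrow> (int \<Rightarrow> 'a \<Rightarrow> real) \<Rightarrow> int \<Rightarrow> 'a \<Rightarrow> real Matrix.vec" where
  "eta_vec s eps t \<omega> = Matrix.vec s (\<lambda>i. (eps (int s * t + int (i + 1)) \<omega>)\<^sup>2)"

text \<open>In the following, \<open>u\<close> is a value of \<open>eta_vec s eps t\<close>, so that \<open>u $ (v - 1)\<close> is
  $\eta_{st+v}$.\<close>

definition pgarch_phi ::
  "nat \<Rightarrow> nat \<Rightarrow> (nat \<Rightarrow> nat \<Rightarrow> real) \<Rightarrow> (nat \<Rightarrow> nat \<Rightarrow> real) \<Rightarrow> nat \<Rightarrow> real Matrix.vec \<Rightarrow> real mat"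
where
  "pgarch_phi p q alpha beta v u = four_block_mat
     (Matrix.mat p p (\<lambda>(i, j). if i = 0 then alpha (j + 1) v * u $ (v - 1)
                               else if i = j + 1 then 1 else 0))
     (Matrix.mat p q (\<lambda>(i, j). if i = 0 then beta (j + 1) v * u $ (v - 1) else 0))
     (Matrix.mat q p (\<lambda>(i, j). if i = 0 then alpha (j + 1) v else 0))
     (Matrix.mat q q (\<lambda>(i, j). if i = 0 then beta (j + 1) v
                               else if i = j + 1 then 1 else 0))"

definition pgarch_b ::
  "nat \<Rightarrow> nat \<Rightarrow> (nat \<Rightarrow> nat \<Rightarrow> real) \<Rightarrow> nat \<Rightarrow> real Matrix.vec \<Rightarrow> real Matrix.vec"
where
  "pgarch_b p q alpha v u = Matrix.vec (p + q)
     (\<lambda>i. if i = 0 then alpha 0 v * u $ (v - 1) else if i = p then alpha 0 v else 0)"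

text \<open>Row \<open>i\<close> of a matrix or vector of size \<open>(p + q) * s\<close> is row \<open>i mod (p + q)\<close> of block
  number \<open>i div (p + q) + 1\<close>.\<close>

definition pgarch_A ::
  "nat \<Rightarrow> nat \<Rightarrow> nat \<Rightarrow> (nat \<Rightarrow> nat \<Rightarrow> real) \<Rightarrow> (nat \<Rightarrow> nat \<Rightarrow> real) \<Rightarrow> real Matrix.vec \<Rightarrow> real mat"
where
  "pgarch_A s p q alpha beta u =
    (let d = p + q in Matrix.mat (d * s) (d * s) (\<lambda>(i, j).
       if j div d = s - 1
       then (let v = i div d + 1 in
              mat_prod d (\<lambda>k. pgarch_phi p q alpha beta (v - k) u) v $$ (i mod d, j mod d))
       else 0))"

definition pgarch_B ::
  "nat \<Rightarrow> nat \<Rightarrow> nat \<Rightarrow> (nat \<Rightarrow> nat \<Rightarrow> real) \<Rightarrow> (nat \<Rightarrow> nat \<Rightarrow> real) \<Rightarrow> real Matrix.vec \<Rightarrow> real Matrix.vec"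
where
  "pgarch_B s p q alpha beta u =
    (let d = p + q in Matrix.vec (d * s) (\<lambda>i.
       let v = i div d + 1 in
         \<Sum>k = 1..v. (mat_prod d (\<lambda>l. pgarch_phi p q alpha beta (v - l) u) (v - k)
                        *\<^sub>v pgarch_b p q alpha k u) $ (i mod d)))"

text \<open>The law of \<open>eta_vec s eps t\<close> does not depend on \<open>t\<close>, so the mean is taken at \<open>t = 0\<close>.\<close>

definition pgarch_mean_phi ::
  "'a measure \<Rightarrow> nat \<Rightarrow> nat \<Rightarrow> nat \<Rightarrow> (nat \<Rightarrow> nat \<Rightarrow> real) \<Rightarrow> (nat \<Rightarrow> nat \<Rightarrow> real) \<Rightarrow>
   (int \<Rightarrow> 'a \<Rightarrow> real) \<Rightarrow> nat \<Rightarrow> real mat"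
where
  "pgarch_mean_phi M s p q alpha beta eps v =
     mean_mat M (p + q) (p + q) (\<lambda>\<omega>. pgarch_phi p q alpha beta v (eta_vec s eps 0 \<omega>))"

lemma pgarch_mean_phi_eq:
  fixes M :: "'a measure"
  assumes "prob_space M"
    and m2: "\<And>t. (\<integral>\<omega>. (eps t \<omega>)\<^sup>2 \<partial>M) = 1"
    and v: "v \<in> {1..s}"
  shows "pgarch_mean_phi M s p q alpha beta eps v
       = pgarch_phi p q alpha beta v (Matrix.vec s (\<lambda>_. 1))"
proof -
  interpret prob_space M by fact
  have "v - 1 < s" using v by auto
  then show ?thesis
    unfolding pgarch_mean_phi_def mean_mat_def pgarch_phi_def eta_vec_def
    by (intro eq_matI) (auto simp: four_block_mat_def Let_def m2 prob_space)
qed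

definition pgarch_vector_solution ::
  "'a measure \<Rightarrow> nat \<Rightarrow> nat \<Rightarrow> nat \<Rightarrow> (nat \<Rightarrow> nat \<Rightarrow> real) \<Rightarrow> (nat \<Rightarrow> nat \<Rightarrow> real) \<Rightarrow>
   (int \<Rightarrow> 'a \<Rightarrow> real) \<Rightarrow> (int \<Rightarrow> 'a \<Rightarrow> real Matrix.vec) \<Rightarrow> bool"
where
  "pgarch_vector_solution M s p q alpha beta eps Y \<longleftrightarrow>
     (\<forall>t. Y t \<in> M \<rightarrow>\<^sub>M vec_borel ((p + q) * s)) \<and>
     (\<forall>t. AE \<omega> in M. \<forall>i < (p + q) * s. 0 \<le> Y t \<omega> $ i) \<and>
     (\<forall>t. AE \<omega> in M. Y t \<omega> = pgarch_A s p q alpha beta (eta_vec s eps t \<omega>) *\<^sub>v Y (t - 1) \<omega>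
                              + pgarch_B s p q alpha beta (eta_vec s eps t \<omega>))"

definition stationary_L1_solution ::
  "'a measure \<Rightarrow> nat \<Rightarrow> nat \<Rightarrow> nat \<Rightarrow> (nat \<Rightarrow> nat \<Rightarrow> real) \<Rightarrow> (nat \<Rightarrow> nat \<Rightarrow> real) \<Rightarrow>
   (int \<Rightarrow> 'a \<Rightarrow> real) \<Rightarrow> (int \<Rightarrow> 'a \<Rightarrow> real Matrix.vec) \<Rightarrow> bool"
where
  "stationary_L1_solution M s p q alpha beta eps Y \<longleftrightarrow>
     pgarch_vector_solution M s p q alpha beta eps Y \<and>
     strictly_stationary M (vec_borel ((p + q) * s)) Y \<and>
     (\<forall>t. integrable M (\<lambda>\<omega>. vec_norm (Y t \<omega>)))"

definition unique_stationary_L1_solution ::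
  "'a measure \<Rightarrow> nat \<Rightarrow> nat \<Rightarrow> nat \<Rightarrow> (nat \<Rightarrow> nat \<Rightarrow> real) \<Rightarrow> (nat \<Rightarrow> nat \<Rightarrow> real) \<Rightarrow>
   (int \<Rightarrow> 'a \<Rightarrow> real) \<Rightarrow> (int \<Rightarrow> 'a \<Rightarrow> real Matrix.vec) \<Rightarrow> bool"
where
  "unique_stationary_L1_solution M s p q alpha beta eps Y \<longleftrightarrow>
     stationary_L1_solution M s p q alpha beta eps Y \<and>
     (\<forall>Y'. stationary_L1_solution M s p q alpha beta eps Y' \<longrightarrow>
        (\<forall>t. AE \<omega> in M. Y' t \<omega> = Y t \<omega>))"

definition causal_process ::
  "'a measure \<Rightarrow> nat \<Rightarrow> nat \<Rightarrow> (int \<Rightarrow> 'a \<Rightarrow> real) \<Rightarrow> (int \<Rightarrow> 'a \<Rightarrow> real Matrix.vec) \<Rightarrow> bool"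
where
  "causal_process M s n eps Y \<longleftrightarrow>
     (\<exists>f \<in> Pi\<^sub>M (UNIV :: nat set) (\<lambda>_. vec_borel s) \<rightarrow>\<^sub>M vec_borel n.
        \<forall>t. AE \<omega> in M. Y t \<omega> = f (\<lambda>k. eta_vec s eps (t - int k) \<omega>))"

end

theory Submission
  imports Defs "Jordan_Normal_Form.Jordan_Normal_Form_Existence"
begin

text \<open>
  Written time by time, the equation for whole periods is a recursion
  \<open>y t = M t * y (t - 1) + b t\<close> in dimension \<open>p + q\<close> whose coefficients are nonnegative, depend on
  the noise at time \<open>t\<close> only, and have expectations of period \<open>s\<close> in \<open>t\<close>
  (\<open>pgarch_equation_iff\<close>, \<open>solves_state_iff\<close>). Iterating it produces the terms
  \<open>M t * \<dots> * M (t - k + 1) * b (t - k)\<close>, called lag terms below. By independence the expectation of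
  a lag term is the lag term of the expectations (\<open>path_lag_expectation\<close>), and everything is nonnegative,
  so the question is whether these deterministic terms are summable over \<open>k\<close>.

  If the product \<open>\<Phi>\<close> of the mean matrices over one period has spectral radius below 1, its powers decay
  geometrically, \<open>y = \<Phi> * y + B\<close> has a nonnegative solution, and the resulting periodic solution of the
  mean recursion bounds all partial sums (\<open>summable_of_spectral_radius\<close>). The series of lag terms then
  converges almost surely and in mean. Its sum is a causal solution, and as a function of the shifted
  noise path it is stationary and ergodic, because independent identically distributed sequences are
  mixing (\<open>factor_of_iid_ergodic\<close>). It is the only integrable stationary solution: the difference of two
  such solutions is at most a product of \<open>k\<close> coefficient matrices, which tends to 0 in mean, times
  a factor that is bounded in mean. No independence between the two factors is needed, since
  square roots of products are controlled by the arithmetic-geometric mean inequality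
  (\<open>solution_unique\<close>).

  Conversely, every nonnegative solution, causal or not, dominates the partial sums of its lag terms, so
  integrability makes the mean lag terms summable (\<open>summable_of_integrable_solution\<close>). Their sum has
  positive components, since the constants \<open>\<alpha>\<^sub>0 > 0\<close> enter at two coordinates and are moved through all
  the others by the ones on the subdiagonals (\<open>mean_lag_pos\<close>). An eigenvalue of \<open>\<Phi>\<close> of modulus at least 1
  would have an eigenvector dominated in modulus by a multiple of this positive vector, and iterating
  contradicts that the tails of the series vanish (\<open>spectral_radius_of_summable\<close>).
\<close>

section \<open>Deterministic linear recursions with nonnegative coefficients\<close>

text \<open>For matrices \<open>m t\<close> and vectors \<open>b t\<close> of dimension \<open>d\<close>, given by their entries,
  \<open>lag_term d m b k t\<close> is the vector \<open>m t * m (t - 1) * \<dots> * m (t - k + 1) * b (t - k)\<close>: the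
  contribution made at time \<open>t\<close> by the input at time \<open>t - k\<close> to a solution of
  \<open>y t = m t * y (t - 1) + b t\<close>.\<close>

primrec lag_term ::
  "nat \<Rightarrow> (int \<Rightarrow> nat \<Rightarrow> nat \<Rightarrow> real) \<Rightarrow> (int \<Rightarrow> nat \<Rightarrow> real) \<Rightarrow> nat \<Rightarrow> int \<Rightarrow> nat \<Rightarrow> real"
where
  "lag_term d m b 0 t i = b t i"
| "lag_term d m b (Suc k) t i = (\<Sum>j<d. m t i j * lag_term d m b k (t - 1) j)"

lemma lag_term_nonneg:
  assumes "\<And>t i j. i < d \<Longrightarrow> j < d \<Longrightarrow> 0 \<le> m t i j" "\<And>t i. i < d \<Longrightarrow> 0 \<le> b t i"
    and "i < d"
  shows "0 \<le> lag_term d m b k t i"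
  using \<open>i < d\<close>
  by (induction k arbitrary: t i) (auto intro!: sum_nonneg mult_nonneg_nonneg assms)

lemma lag_term_cong:
  assumes "\<And>t' i j. t' \<le> t \<Longrightarrow> i < d \<Longrightarrow> j < d \<Longrightarrow> m t' i j = m' t' i j"
    and "\<And>t' i. t' \<le> t \<Longrightarrow> i < d \<Longrightarrow> b t' i = b' t' i"
    and "i < d"
  shows "lag_term d m b k t i = lag_term d m' b' k t i"
  using assms by (induction k arbitrary: t i) auto

lemma lag_term_shift:
  "lag_term d (\<lambda>t. m (t + h)) (\<lambda>t. b (t + h)) k t i = lag_term d m b k (t + h) i"
  by (induction k arbitrary: t i) (auto simp: algebra_simps)

lemma lag_term_partial_sum:
  "(\<Sum>k<Suc N. lag_term d m b k t i)
     = b t i + (\<Sum>j<d. m t i j * (\<Sum>k<N. lag_term d m b k (t - 1) j))"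
proof -
  have "(\<Sum>k<Suc N. lag_term d m b k t i) = b t i + (\<Sum>k<N. lag_term d m b (Suc k) t i)"
    by (simp only: sum.lessThan_Suc_shift) simp
  also have "(\<Sum>k<N. lag_term d m b (Suc k) t i)
      = (\<Sum>j<d. m t i j * (\<Sum>k<N. lag_term d m b k (t - 1) j))"
    by (simp add: sum_distrib_left) (rule sum.swap)
  finally show ?thesis .
qed

lemma lag_term_partial_sum_le:
  assumes m: "\<And>t i j. i < d \<Longrightarrow> j < d \<Longrightarrow> 0 \<le> m t i j"
    and g: "\<And>t i. i < d \<Longrightarrow> 0 \<le> g t i"
    and super: "\<And>t i. i < d \<Longrightarrow> b t i + (\<Sum>j<d. m t i j * g (t - 1) j) \<le> g t i"
    and "i < d"
  shows "(\<Sum>k<N. lag_term d m b k t i) \<le> g t i"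
  using \<open>i < d\<close>
proof (induction N arbitrary: t i)
  case 0
  then show ?case using g by simp
next
  case (Suc N)
  have "(\<Sum>k<Suc N. lag_term d m b k t i) \<le> b t i + (\<Sum>j<d. m t i j * g (t - 1) j)"
    unfolding lag_term_partial_sum using Suc
    by (intro add_left_mono sum_mono mult_left_mono m) auto
  also have "\<dots> \<le> g t i" using super Suc.prems by simp
  finally show ?case .
qed

lemma lag_term_summable:
  assumes "\<And>t i j. i < d \<Longrightarrow> j < d \<Longrightarrow> 0 \<le> m t i j" "\<And>t i. i < d \<Longrightarrow> 0 \<le> b t i"
    and "\<And>t i. i < d \<Longrightarrow> 0 \<le> g t i"
    and "\<And>t i. i < d \<Longrightarrow> b t i + (\<Sum>j<d. m t i j * g (t - 1) j) \<le> g t i"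
    and "i < d"
  shows "summable (\<lambda>k. lag_term d m b k t i)"
  by (rule summableI_nonneg_bounded[where x = "g t i"])
     (auto intro!: lag_term_nonneg lag_term_partial_sum_le assms)

lemma suminf_lag_term:
  assumes sm: "\<And>j. j < d \<Longrightarrow> summable (\<lambda>k. lag_term d m b k (t - 1) j)"
  shows "(\<Sum>k. lag_term d m b k t i)
           = b t i + (\<Sum>j<d. m t i j * (\<Sum>k. lag_term d m b k (t - 1) j))"
    and "summable (\<lambda>k. lag_term d m b k t i)"
proof -
  have "(\<lambda>k. \<Sum>j<d. m t i j * lag_term d m b k (t - 1) j)
          sums (\<Sum>j<d. m t i j * (\<Sum>k. lag_term d m b k (t - 1) j))"
    by (intro sums_sum sums_mult summable_sums sm) auto
  then have "(\<lambda>k. lag_term d m b (Suc k) t i)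
          sums (\<Sum>j<d. m t i j * (\<Sum>k. lag_term d m b k (t - 1) j))"
    by simp
  then have s: "(\<lambda>k. lag_term d m b k t i)
          sums ((\<Sum>j<d. m t i j * (\<Sum>k. lag_term d m b k (t - 1) j)) + lag_term d m b 0 t i)"
    by (rule sums_Suc)
  from sums_unique[OF this] show "(\<Sum>k. lag_term d m b k t i)
           = b t i + (\<Sum>j<d. m t i j * (\<Sum>k. lag_term d m b k (t - 1) j))"
    by simp
  from s show "summable (\<lambda>k. lag_term d m b k t i)" by (rule sums_summable)
qed

text \<open>With constant input 1 the lag terms are the row sums of the matrix products, which control
  every solution of the homogeneous recursion.\<close>

lemma homogeneous_le_lag_term:
  assumes m: "\<And>t i j. i < d \<Longrightarrow> j < d \<Longrightarrow> 0 \<le> m t i j"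
    and hom: "\<And>t i. i < d \<Longrightarrow> D t i = (\<Sum>j<d. m t i j * D (t - 1) j)"
    and K: "\<And>j. j < d \<Longrightarrow> \<bar>D (t - int k) j\<bar> \<le> K"
    and "i < d"
  shows "\<bar>D t i\<bar> \<le> lag_term d m (\<lambda>_ _. 1) k t i * K"
  using K \<open>i < d\<close>
proof (induction k arbitrary: t i)
  case 0
  then show ?case by simp
next
  case (Suc k)
  have IH: "\<bar>D (t - 1) j\<bar> \<le> lag_term d m (\<lambda>_ _. 1) k (t - 1) j * K" if "j < d" for j
    using Suc.IH[of "t - 1" j] Suc.prems(1) that by (simp add: algebra_simps)
  have "\<bar>D t i\<bar> \<le> (\<Sum>j<d. m t i j * \<bar>D (t - 1) j\<bar>)"
    unfolding hom[OF \<open>i < d\<close>, of t] by (rule order_trans[OF sum_abs]) (simp add: abs_mult m \<open>i < d\<close>)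
  also have "\<dots> \<le> (\<Sum>j<d. m t i j * (lag_term d m (\<lambda>_ _. 1) k (t - 1) j * K))"
    by (intro sum_mono mult_left_mono m IH) (auto simp: \<open>i < d\<close>)
  also have "\<dots> = lag_term d m (\<lambda>_ _. 1) (Suc k) t i * K"
    by (simp add: sum_distrib_right mult.assoc)
  finally show ?case .
qed

text \<open>If the homogeneous recursion starts below a multiple of the sum of the lag terms, it stays below
  the same multiple of the tails of that series: one step of the recursion turns the lag terms from
  index \<open>n\<close> on into those from index \<open>n + 1\<close> on.\<close>

lemma homogeneous_le_tail:
  assumes m: "\<And>t i j. i < d \<Longrightarrow> j < d \<Longrightarrow> 0 \<le> m t i j"
    and sm: "\<And>t j. j < d \<Longrightarrow> summable (\<lambda>k. lag_term d m b k t j)"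
    and u0: "\<And>i. i < d \<Longrightarrow> u 0 i \<le> C * (\<Sum>k. lag_term d m b k t i)"
    and u: "\<And>n i. i < d \<Longrightarrow> u (Suc n) i = (\<Sum>j<d. m (t + int (Suc n)) i j * u n j)"
    and "i < d"
  shows "u n i \<le> C * (\<Sum>k. lag_term d m b (k + n) (t + int n) i)"
  using \<open>i < d\<close>
proof (induction n arbitrary: i)
  case 0
  then show ?case using u0 by simp
next
  case (Suc n)
  have "u (Suc n) i \<le> (\<Sum>j<d. m (t + int (Suc n)) i j
          * (C * (\<Sum>k. lag_term d m b (k + n) (t + int n) j)))"
    unfolding u[OF Suc.prems] by (intro sum_mono mult_left_mono m Suc.IH) (auto simp: Suc.prems)
  also have "\<dots> = C * (\<Sum>j<d. m (t + int (Suc n)) i j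
          * (\<Sum>k. lag_term d m b (k + n) (t + int n) j))"
    by (simp add: sum_distrib_left mult_ac)
  also have "(\<Sum>j<d. m (t + int (Suc n)) i j * (\<Sum>k. lag_term d m b (k + n) (t + int n) j))
      = (\<Sum>k. \<Sum>j<d. m (t + int (Suc n)) i j * lag_term d m b (k + n) (t + int n) j)"
    by (intro sums_unique sums_sum sums_mult summable_sums summable_ignore_initial_segment sm) auto
  also have "\<dots> = (\<Sum>k. lag_term d m b (k + Suc n) (t + int (Suc n)) i)"
    by simp
  finally show ?case .
qed

section \<open>Measurability of vector-valued functions\<close>

lemma measurable_vec_borel_component:
  assumes "i < n"
  shows "(\<lambda>v. v $ i) \<in> vec_borel n \<rightarrow>\<^sub>M borel"
proof -
  have "(\<lambda>v. \<lambda>i\<in>{..<n}. v $ i) \<in> vec_borel n \<rightarrow>\<^sub>M Pi\<^sub>M {..<n} (\<lambda>_. borel)"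
    unfolding vec_borel_def by (rule measurable_vimage_algebra1) (auto simp: space_PiM)
  from measurable_compose[OF this measurable_component_singleton[of i]] assms
  show ?thesis by simp
qed

lemma measurable_vec_borelI:
  assumes "\<And>x. x \<in> space M \<Longrightarrow> f x \<in> carrier_vec n"
    and "\<And>i. i < n \<Longrightarrow> (\<lambda>x. f x $ i) \<in> borel_measurable M"
  shows "f \<in> M \<rightarrow>\<^sub>M vec_borel n"
  unfolding vec_borel_def
proof (rule measurable_vimage_algebra2)
  show "f \<in> space M \<rightarrow> carrier_vec n" using assms(1) by auto
  show "(\<lambda>x. \<lambda>i\<in>{..<n}. f x $ i) \<in> M \<rightarrow>\<^sub>M Pi\<^sub>M {..<n} (\<lambda>_. borel)"
    by (rule measurable_restrict) (auto intro: assms(2))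
qed

lemma abs_component_le_vec_norm: "i < dim_vec v \<Longrightarrow> \<bar>v $ i\<bar> \<le> vec_norm v"
  unfolding vec_norm_def
  using member_le_L2_set[of "{..<dim_vec v}" i "\<lambda>i. \<bar>v $ i\<bar>"]
  by (simp add: L2_set_def)

lemma integrable_vec_norm:
  assumes Y: "Y \<in> M \<rightarrow>\<^sub>M vec_borel n"
    and int: "\<And>i. i < n \<Longrightarrow> integrable M (\<lambda>\<omega>. Y \<omega> $ i)"
  shows "integrable M (\<lambda>\<omega>. vec_norm (Y \<omega>))"
proof (rule Bochner_Integration.integrable_bound)
  have dim: "dim_vec (Y \<omega>) = n" if "\<omega> \<in> space M" for \<omega>
    using measurable_space[OF Y that] by auto
  show "integrable M (\<lambda>\<omega>. \<Sum>i<n. \<bar>Y \<omega> $ i\<bar>)"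
    using int by (intro Bochner_Integration.integrable_sum integrable_abs) auto
  have [measurable]: "(\<lambda>\<omega>. Y \<omega> $ i) \<in> borel_measurable M" if "i < n" for i
    using int[OF that] by auto
  have "(\<lambda>\<omega>. sqrt (\<Sum>i<n. (Y \<omega> $ i)\<^sup>2)) \<in> borel_measurable M"
    by measurable
  then show "(\<lambda>\<omega>. vec_norm (Y \<omega>)) \<in> borel_measurable M"
    by (rule measurable_cong[THEN iffD1, rotated]) (simp add: vec_norm_def L2_set_def dim)
  show "AE \<omega> in M. norm (vec_norm (Y \<omega>)) \<le> norm (\<Sum>i<n. \<bar>Y \<omega> $ i\<bar>)"
  proof (rule AE_I2)
    fix \<omega> assume "\<omega> \<in> space M"
    then have "vec_norm (Y \<omega>) \<le> (\<Sum>i<n. \<bar>Y \<omega> $ i\<bar>)"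
      unfolding vec_norm_def using dim L2_set_le_sum_abs by metis
    moreover have "0 \<le> vec_norm (Y \<omega>)" by (simp add: vec_norm_def L2_set_nonneg)
    ultimately show "norm (vec_norm (Y \<omega>)) \<le> norm (\<Sum>i<n. \<bar>Y \<omega> $ i\<bar>)" by simp
  qed
qed

lemma integrable_component:
  assumes Y: "Y \<in> M \<rightarrow>\<^sub>M vec_borel n" and int: "integrable M (\<lambda>\<omega>. vec_norm (Y \<omega>))"
    and "i < n"
  shows "integrable M (\<lambda>\<omega>. Y \<omega> $ i)"
proof (rule Bochner_Integration.integrable_bound[OF int])
  show "(\<lambda>\<omega>. Y \<omega> $ i) \<in> borel_measurable M"
    by (rule measurable_compose[OF Y measurable_vec_borel_component[OF \<open>i < n\<close>]])
  show "AE \<omega> in M. norm (Y \<omega> $ i) \<le> norm (vec_norm (Y \<omega>))"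
  proof (rule AE_I2)
    fix \<omega> assume "\<omega> \<in> space M"
    then have "dim_vec (Y \<omega>) = n" using measurable_space[OF Y] by auto
    then show "norm (Y \<omega> $ i) \<le> norm (vec_norm (Y \<omega>))"
      using abs_component_le_vec_norm[of i "Y \<omega>"] \<open>i < n\<close> by simp
  qed
qed

section \<open>Ordered products of matrices and block recursions\<close>

lemma mult_mat_vec_component:
  "i < dim_row A \<Longrightarrow> dim_col A = dim_vec v \<Longrightarrow> (A *\<^sub>v v) $ i = (\<Sum>j<dim_vec v. A $$ (i, j) * v $ j)"
  by (simp add: scalar_prod_def atLeast0LessThan)

text \<open>Matrix-vector products are expanded into sums over entries rather than scalar products of rows.\<close>

declare index_mult_mat_vec [simp del]

lemma mat_prod_0 [simp]: "mat_prod n F 0 = 1\<^sub>m n"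
  by (simp add: mat_prod_def)

lemma mat_prod_Suc: "mat_prod n F (Suc m) = F 0 * mat_prod n (\<lambda>i. F (Suc i)) m"
proof -
  have "[0..<Suc m] = 0 # map Suc [0..<m]"
    by (simp add: map_Suc_upt upt_conv_Cons del: upt_Suc)
  then show ?thesis by (simp add: mat_prod_def foldr_map comp_def del: upt_Suc)
qed

lemma mat_prod_cong:
  assumes "\<And>i. i < m \<Longrightarrow> F i = G i"
  shows "mat_prod n F m = mat_prod n G m"
  unfolding mat_prod_def by (rule foldr_cong) (use assms in auto)

lemma mat_prod_carrier:
  assumes "\<And>i. i < m \<Longrightarrow> F i \<in> carrier_mat n n"
  shows "mat_prod n F m \<in> carrier_mat n n"
  using assms
proof (induction m arbitrary: F)
  case (Suc m)
  have "mat_prod n (\<lambda>i. F (Suc i)) m \<in> carrier_mat n n" using Suc.prems by (intro Suc.IH) auto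
  with Suc.prems[of 0] show ?case by (auto simp: mat_prod_Suc)
qed auto

lemma mat_prod_descending:
  assumes "k \<le> v"
  shows "mat_prod n (\<lambda>l. N (Suc v - l)) (Suc v - k) = N (Suc v) * mat_prod n (\<lambda>l. N (v - l)) (v - k)"
  using assms by (simp add: Suc_diff_le mat_prod_Suc)

text \<open>The state after \<open>v\<close> steps of \<open>h v = N v * h (v - 1) + c v\<close> started from \<open>x\<close>, written out as
  a sum of products.\<close>

definition block_value ::
  "nat \<Rightarrow> (nat \<Rightarrow> real mat) \<Rightarrow> (nat \<Rightarrow> real Matrix.vec) \<Rightarrow> real Matrix.vec \<Rightarrow> nat \<Rightarrow> nat \<Rightarrow> real"
where
  "block_value d N c x v i = (mat_prod d (\<lambda>l. N (v - l)) v *\<^sub>v x) $ i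
     + (\<Sum>k = 1..v. (mat_prod d (\<lambda>l. N (v - l)) (v - k) *\<^sub>v c k) $ i)"

lemma block_value_0:
  assumes "x \<in> carrier_vec d" "i < d"
  shows "block_value d N c x 0 i = x $ i"
  using assms by (simp add: block_value_def)

lemma block_value_Suc:
  assumes N: "\<And>v. N v \<in> carrier_mat d d" and c: "\<And>v. c v \<in> carrier_vec d"
    and x: "x \<in> carrier_vec d" and i: "i < d"
  shows "block_value d N c x (Suc v) i
           = c (Suc v) $ i + (\<Sum>j<d. N (Suc v) $$ (i, j) * block_value d N c x v j)"
proof -
  let ?P = "\<lambda>v k. mat_prod d (\<lambda>l. N (v - l)) (v - k)"
  have P: "?P v k \<in> carrier_mat d d" for v k by (intro mat_prod_carrier N)
  have step: "(?P (Suc v) k *\<^sub>v z) $ i = (\<Sum>j<d. N (Suc v) $$ (i, j) * (?P v k *\<^sub>v z) $ j)"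
    if "k \<le> v" and z: "z \<in> carrier_vec d" for k z
  proof -
    have "?P (Suc v) k *\<^sub>v z = N (Suc v) *\<^sub>v (?P v k *\<^sub>v z)"
      unfolding mat_prod_descending[OF \<open>k \<le> v\<close>] using N P z by (rule assoc_mult_mat_vec)
    moreover have "dim_vec (?P v k *\<^sub>v z) = d" using P[of v k] by simp
    ultimately show ?thesis using N[of "Suc v"] i by (simp add: mult_mat_vec_component)
  qed
  have "block_value d N c x (Suc v) i = (?P (Suc v) 0 *\<^sub>v x) $ i
      + ((\<Sum>k = 1..v. (?P (Suc v) k *\<^sub>v c k) $ i) + c (Suc v) $ i)"
    using c[of "Suc v"] by (simp add: block_value_def)
  also have "\<dots> = c (Suc v) $ i + (\<Sum>j<d. N (Suc v) $$ (i, j) *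
      ((?P v 0 *\<^sub>v x) $ j + (\<Sum>k = 1..v. (?P v k *\<^sub>v c k) $ j)))"
    using c x
    by (subst step, simp, simp, subst sum.cong[OF refl step])
       (auto simp: distrib_left sum.distrib sum_distrib_left sum.swap[of _ "{..<d}"])
  finally show ?thesis by (simp add: block_value_def)
qed

lemma block_value_eq_add:
  assumes N: "\<And>v. N v \<in> carrier_mat d d" and i: "i < d"
  shows "block_value d N c (Matrix.vec d x) v i
           = (\<Sum>j<d. mat_prod d (\<lambda>l. N (v - l)) v $$ (i, j) * x j) + block_value d N c (0\<^sub>v d) v i"
proof -
  have P: "mat_prod d (\<lambda>l. N (v - l)) v \<in> carrier_mat d d" by (intro mat_prod_carrier N)
  then have "mat_prod d (\<lambda>l. N (v - l)) v *\<^sub>v 0\<^sub>v d = 0\<^sub>v d"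
    by (intro eq_vecI) (auto simp: mult_mat_vec_component)
  moreover have "(mat_prod d (\<lambda>l. N (v - l)) v *\<^sub>v Matrix.vec d x) $ i
      = (\<Sum>j<d. mat_prod d (\<lambda>l. N (v - l)) v $$ (i, j) * x j)"
    using P i by (subst mult_mat_vec_component) auto
  ultimately show ?thesis
    using i by (simp add: block_value_def)
qed

lemma block_value_nonneg:
  assumes N: "\<And>v. N v \<in> carrier_mat d d" and c: "\<And>v. c v \<in> carrier_vec d"
    and x: "x \<in> carrier_vec d" and "\<And>i. i < d \<Longrightarrow> 0 \<le> x $ i"
    and "\<And>v i j. v \<in> {1..s} \<Longrightarrow> i < d \<Longrightarrow> j < d \<Longrightarrow> 0 \<le> N v $$ (i, j)"
    and "\<And>v i. v \<in> {1..s} \<Longrightarrow> i < d \<Longrightarrow> 0 \<le> c v $ i"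
    and "v \<le> s" "i < d"
  shows "0 \<le> block_value d N c x v i"
  using \<open>v \<le> s\<close> \<open>i < d\<close>
proof (induction v arbitrary: i)
  case 0
  then show ?case using assms by (simp add: block_value_0)
next
  case (Suc v)
  then show ?case
    by (subst block_value_Suc[OF N c x])
       (auto intro!: add_nonneg_nonneg sum_nonneg mult_nonneg_nonneg assms)
qed

lemma block_value_zero:
  assumes N: "\<And>v. N v \<in> carrier_mat d d" and "i < d"
  shows "block_value d N (\<lambda>_. 0\<^sub>v d) (0\<^sub>v d) v i = 0"
  using \<open>i < d\<close>
proof (induction v arbitrary: i)
  case 0
  then show ?case by (simp add: block_value_0)
next
  case (Suc v)
  then show ?case by (subst block_value_Suc[OF N]) auto
qed

lemma mat_prod_nonneg:
  assumes N: "\<And>v. N v \<in> carrier_mat d d"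
    and nn: "\<And>v i j. v \<in> {1..s} \<Longrightarrow> i < d \<Longrightarrow> j < d \<Longrightarrow> 0 \<le> N v $$ (i, j)"
    and "v \<le> s" "i < d" "j < d"
  shows "0 \<le> mat_prod d (\<lambda>l. N (v - l)) v $$ (i, j)"
proof -
  have "0 \<le> block_value d N (\<lambda>_. 0\<^sub>v d) (Matrix.vec d (\<lambda>l. if l = j then 1 else 0)) v i"
    using assms by (intro block_value_nonneg[where s = s]) auto
  moreover have "block_value d N (\<lambda>_. 0\<^sub>v d) (0\<^sub>v d) v i = 0"
    using N \<open>i < d\<close> by (rule block_value_zero)
  ultimately show ?thesis
    using N \<open>i < d\<close> \<open>j < d\<close> by (simp add: block_value_eq_add if_distrib cong: if_cong)
qed

section \<open>Spectral radius and summability\<close>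

text \<open>The time within the period: \<open>season s (s * t + v) = v\<close> for \<open>v \<in> {1..s}\<close>.\<close>

definition season :: "nat \<Rightarrow> int \<Rightarrow> nat" where
  "season s t = nat ((t - 1) mod int s) + 1"

lemma season_in: "1 \<le> s \<Longrightarrow> season s t \<in> {1..s}"
  using pos_mod_bound[of "int s" "t - 1"] pos_mod_sign[of "int s" "t - 1"]
  by (auto simp: season_def Suc_le_eq nat_less_iff)

lemma season_eq: "v < s \<Longrightarrow> season s (int s * t + int (Suc v)) = Suc v"
  by (simp add: season_def)

lemma season_add_period: "season s (t + int s * h) = season s t"
  by (simp add: season_def add.commute diff_add_eq[symmetric] add_diff_eq)

lemma lag_term_constant_Suc:
  "lag_term d (\<lambda>_. m) (\<lambda>_. b) (Suc k) t i = lag_term d (\<lambda>_. m) (\<lambda>_ i. \<Sum>j<d. m i j * b j) k t' i"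
proof (induction k arbitrary: t t' i)
  case (Suc k)
  have "lag_term d (\<lambda>_. m) (\<lambda>_. b) (Suc (Suc k)) t i
      = (\<Sum>j<d. m i j * lag_term d (\<lambda>_. m) (\<lambda>_. b) (Suc k) (t - 1) j)"
    by (rule lag_term.simps(2))
  also have "\<dots> = lag_term d (\<lambda>_. m) (\<lambda>_ i. \<Sum>j<d. m i j * b j) (Suc k) t' i"
    unfolding Suc.IH[where t' = "t' - 1"] by (rule lag_term.simps(2)[symmetric])
  finally show ?case .
qed simp

lemma lag_term_constant_scale:
  "lag_term d (\<lambda>_ i j. r * m i j) (\<lambda>_. b) k t i = r ^ k * lag_term d (\<lambda>_. m) (\<lambda>_. b) k t i"
  by (induction k arbitrary: t i) (auto simp: sum_distrib_left mult_ac)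

lemma pow_mat_mult_vec_eq_lag_term:
  assumes "A \<in> carrier_mat d d" "\<And>i j. i < d \<Longrightarrow> j < d \<Longrightarrow> A $$ (i, j) = complex_of_real (m i j)"
    and "i < d"
  shows "(A ^\<^sub>m k *\<^sub>v Matrix.vec d (\<lambda>j. complex_of_real (b j))) $ i
           = complex_of_real (lag_term d (\<lambda>_. m) (\<lambda>_. b) k t i)"
  using \<open>i < d\<close>
proof (induction k arbitrary: b i t)
  case 0
  then show ?case using assms(1) by simp
next
  case (Suc k)
  have "A *\<^sub>v Matrix.vec d (\<lambda>j. complex_of_real (b j))
      = Matrix.vec d (\<lambda>i. complex_of_real (\<Sum>j<d. m i j * b j))"
    using assms(1,2) by (intro eq_vecI) (auto simp: mult_mat_vec_component)
  moreover have "A ^\<^sub>m Suc k *\<^sub>v Matrix.vec d (\<lambda>j. complex_of_real (b j))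
      = A ^\<^sub>m k *\<^sub>v (A *\<^sub>v Matrix.vec d (\<lambda>j. complex_of_real (b j)))"
    using assms(1) by (simp add: assoc_mult_mat_vec[of _ d d])
  ultimately show ?case
    using Suc by (simp only: lag_term_constant_Suc[where t' = t])
qed

text \<open>Below spectral radius 1 the powers decay geometrically: a rescaling of the matrix by a factor
  \<open>1 / r > 1\<close> still has spectral radius below 1, so its powers stay bounded by the Jordan normal
  form.\<close>

lemma spectral_radius_less_1_summable:
  fixes F :: "real mat"
  assumes F: "F \<in> carrier_mat d d" and d: "0 < d"
    and sr: "spectral_radius (map_mat complex_of_real F) < 1"
    and i: "i < d"
  shows "summable (\<lambda>k. lag_term d (\<lambda>_ i j. F $$ (i, j)) (\<lambda>_. b) k t i)"
proof -
  let ?C = "map_mat complex_of_real F"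
  have C: "?C \<in> carrier_mat d d" using F by simp
  define \<rho> where "\<rho> = spectral_radius ?C"
  have \<rho>0: "0 \<le> \<rho>" using spectral_radius_mem_max(1)[OF C d] by (auto simp: \<rho>_def)
  define r where "r = (\<rho> + 1) / 2"
  have r: "\<rho> < r" "0 < r" "r < 1" using \<rho>0 sr by (auto simp: r_def \<rho>_def)
  define A where "A = Matrix.mat d d (\<lambda>(i, j). complex_of_real (1 / r * F $$ (i, j)))"
  have A: "A \<in> carrier_mat d d" by (simp add: A_def)
  have CA: "?C *\<^sub>v z = complex_of_real r \<cdot>\<^sub>v (A *\<^sub>v z)" if "z \<in> carrier_vec d" for z
    using that F r by (intro eq_vecI) (auto simp: A_def mult_mat_vec_component sum_distrib_left)
  have "spectral_radius A < 1"
  proof -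
    obtain \<mu> where \<mu>: "\<mu> \<in> spectrum A" "spectral_radius A = norm \<mu>"
      using spectral_radius_mem_max(1)[OF A d] by auto
    then obtain z where z: "eigenvector A z \<mu>"
      by (auto simp: spectrum_def eigenvalue_def)
    then have zc: "z \<in> carrier_vec d" "z \<noteq> 0\<^sub>v d" "A *\<^sub>v z = \<mu> \<cdot>\<^sub>v z"
      using A by (auto simp: eigenvector_def)
    then have "eigenvector ?C z (complex_of_real r * \<mu>)"
      using CA[OF zc(1)] F by (auto simp: eigenvector_def smult_smult_assoc)
    then have "norm (complex_of_real r * \<mu>) \<le> \<rho>"
      unfolding \<rho>_def
      by (intro spectral_radius_mem_max(2)[OF C d] imageI) (auto simp: spectrum_def eigenvalue_def)
    then have "r * norm \<mu> \<le> \<rho>" using r by (simp add: norm_mult)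
    then have "norm \<mu> * r < 1 * r" using r(1) by (subst mult.commute) linarith
    then have "norm \<mu> < 1" by (rule mult_right_less_imp_less) (use r in simp)
    then show ?thesis using \<mu> by simp
  qed
  moreover have "\<exists>n_as. jordan_nf A n_as"
    using char_poly_factorized[OF A] jordan_nf_exists[OF A] by metis
  ultimately obtain c where c: "\<And>k. norm_bound (A ^\<^sub>m k) c"
    using spectral_radius_jnf_norm_bound_less_1[OF A] by blast
  \<comment> \<open>the bound \<open>c\<close> on the entries of the powers, summed against \<open>b\<close>\<close>
  define K where "K = c * (\<Sum>j<d. \<bar>b j\<bar>)"
  have bound: "\<bar>lag_term d (\<lambda>_ i j. 1 / r * F $$ (i, j)) (\<lambda>_. b) k t i\<bar> \<le> K" for k
  proof -
    have "complex_of_real (lag_term d (\<lambda>_ i j. 1 / r * F $$ (i, j)) (\<lambda>_. b) k t i)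
        = (A ^\<^sub>m k *\<^sub>v Matrix.vec d (\<lambda>j. complex_of_real (b j))) $ i"
      using A i by (subst pow_mat_mult_vec_eq_lag_term) (auto simp: A_def)
    also have "\<dots> = (\<Sum>j<d. (A ^\<^sub>m k) $$ (i, j) * complex_of_real (b j))"
      using A i by (subst mult_mat_vec_component) auto
    finally have "norm (complex_of_real (lag_term d (\<lambda>_ i j. 1 / r * F $$ (i, j)) (\<lambda>_. b) k t i))
        = norm (\<Sum>j<d. (A ^\<^sub>m k) $$ (i, j) * complex_of_real (b j))"
      by (rule arg_cong)
    then have "\<bar>lag_term d (\<lambda>_ i j. 1 / r * F $$ (i, j)) (\<lambda>_. b) k t i\<bar>
        = norm (\<Sum>j<d. (A ^\<^sub>m k) $$ (i, j) * complex_of_real (b j))"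
      by (simp only: norm_of_real)
    also have "\<dots> \<le> (\<Sum>j<d. c * \<bar>b j\<bar>)"
    proof (rule order_trans[OF norm_sum sum_mono])
      fix j assume "j \<in> {..<d}"
      then have "norm ((A ^\<^sub>m k) $$ (i, j)) \<le> c"
        using c[of k] A i by (auto simp: norm_bound_def)
      then show "norm ((A ^\<^sub>m k) $$ (i, j) * complex_of_real (b j)) \<le> c * \<bar>b j\<bar>"
        by (simp add: norm_mult mult_right_mono)
    qed
    finally show ?thesis by (simp add: K_def sum_distrib_left)
  qed
  show ?thesis
  proof (rule summable_comparison_test')
    show "summable (\<lambda>k. K * r ^ k)" using r by (intro summable_mult summable_geometric) auto
    fix k :: nat
    have "norm (lag_term d (\<lambda>_ i j. F $$ (i, j)) (\<lambda>_. b) k t i)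
        = \<bar>lag_term d (\<lambda>_ i j. 1 / r * F $$ (i, j)) (\<lambda>_. b) k t i\<bar> * r ^ k"
      unfolding lag_term_constant_scale[of d "1 / r" "\<lambda>i j. F $$ (i, j)"]
      using r by (simp add: abs_mult power_divide)
    also have "\<dots> \<le> K * r ^ k" using r by (intro mult_right_mono bound) auto
    finally show "norm (lag_term d (\<lambda>_ i j. F $$ (i, j)) (\<lambda>_. b) k t i) \<le> K * r ^ k" .
  qed
qed

text \<open>A recursion with nonnegative deterministic coefficients of period \<open>s\<close>. The season \<open>v\<close> of a time
  runs through \<open>1, \<dots>, s\<close>, and nonnegativity is required at these indices only.\<close>

locale periodic_recursion =
  fixes s d :: nat and N :: "nat \<Rightarrow> real mat" and c :: "nat \<Rightarrow> real Matrix.vec"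
  assumes s: "1 \<le> s" and d: "0 < d"
    and N: "\<And>v. N v \<in> carrier_mat d d" and c: "\<And>v. c v \<in> carrier_vec d"
    and N_nonneg: "\<And>v i j. v \<in> {1..s} \<Longrightarrow> i < d \<Longrightarrow> j < d \<Longrightarrow> 0 \<le> N v $$ (i, j)"
    and c_nonneg: "\<And>v i. v \<in> {1..s} \<Longrightarrow> i < d \<Longrightarrow> 0 \<le> c v $ i"
begin

text \<open>The coefficients as functions of the time, and their ordered product over one period.\<close>

abbreviation m where "m \<equiv> \<lambda>t i j. N (season s t) $$ (i, j)"

abbreviation b where "b \<equiv> \<lambda>t i. c (season s t) $ i"

abbreviation monodromy where "monodromy \<equiv> mat_prod d (\<lambda>v. N (s - v)) s"

lemma monodromy_carrier: "monodromy \<in> carrier_mat d d"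
  by (intro mat_prod_carrier N)

lemma m_nonneg: "i < d \<Longrightarrow> j < d \<Longrightarrow> 0 \<le> m t i j"
  using season_in[OF s, of t] by (intro N_nonneg)

lemma b_nonneg: "i < d \<Longrightarrow> 0 \<le> b t i"
  using season_in[OF s, of t] by (intro c_nonneg)

text \<open>The Neumann series of the product over one period yields a nonnegative periodic solution,
  which bounds all partial sums.\<close>

lemma summable_of_spectral_radius:
  assumes sr: "spectral_radius (map_mat complex_of_real monodromy) < 1" and "i < d"
  shows "summable (\<lambda>k. lag_term d m b k t i)"
proof -
  let ?F = "\<lambda>i j. monodromy $$ (i, j)"
  define B where "B i = block_value d N c (0\<^sub>v d) s i" for i
  define y where "y i = (\<Sum>k. lag_term d (\<lambda>_. ?F) (\<lambda>_. B) k 0 i)" for i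
  have indep: "lag_term d (\<lambda>_. ?F) (\<lambda>_. B) k t i = lag_term d (\<lambda>_. ?F) (\<lambda>_. B) k 0 i" for k t i
    using lag_term_shift[of d "\<lambda>_. ?F" t "\<lambda>_. B" k 0 i] by simp
  have sm: "summable (\<lambda>k. lag_term d (\<lambda>_. ?F) (\<lambda>_. B) k t i)" if "i < d" for t i
    using spectral_radius_less_1_summable[OF monodromy_carrier d sr that] .
  have B: "0 \<le> B i" if "i < d" for i
    unfolding B_def using that
    by (intro block_value_nonneg[where s = s] N c N_nonneg c_nonneg) auto
  have F: "0 \<le> ?F i j" if "i < d" "j < d" for i j
    using that by (intro mat_prod_nonneg[where s = s] N N_nonneg) auto
  have y0: "0 \<le> y i" if "i < d" for i
    unfolding y_def using that sm F B by (intro suminf_nonneg lag_term_nonneg) auto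
  have y: "y i = B i + (\<Sum>j<d. ?F i j * y j)" if "i < d" for i
    unfolding y_def using that sm
    by (subst suminf_lag_term(1)) (auto simp: indep[of _ "-1"])
  let ?h = "block_value d N c (Matrix.vec d y)"
  define g where "g t i = ?h (nat (t mod int s)) i" for t i
  have hs: "?h s i = y i" if "i < d" for i
    using y[OF that] that by (simp add: block_value_eq_add[OF N] B_def)
  have step: "b t i + (\<Sum>j<d. m t i j * g (t - 1) j) \<le> g t i" if "i < d" for t i
  proof -
    define v where "v = nat ((t - 1) mod int s)"
    have v: "v < s" "int v = (t - 1) mod int s"
      using s by (auto simp: v_def nat_less_iff)
    have "g (t - 1) j = ?h v j" for j by (simp add: g_def v_def)
    moreover have "season s t = Suc v" by (simp add: season_def v_def)
    ultimately have "b t i + (\<Sum>j<d. m t i j * g (t - 1) j) = ?h (Suc v) i"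
      using that by (simp add: block_value_Suc[OF N c])
    moreover have "g t i = ?h (Suc v) i"
    proof -
      have "t mod int s = (int v + 1) mod int s"
        unfolding v by (simp add: mod_add_left_eq)
      also have "\<dots> = (if Suc v = s then 0 else int (Suc v))"
        using v(1) by (cases "Suc v = s") (auto simp: add.commute)
      finally have "t mod int s = (if Suc v = s then 0 else int (Suc v))" .
      then show ?thesis
        using that hs by (auto simp: g_def block_value_0 nat_add_distrib split: if_splits)
    qed
    ultimately show ?thesis by simp
  qed
  have g0: "0 \<le> g t i" if "i < d" for t i
  proof -
    have "nat (t mod int s) \<le> s" using s by (simp add: nat_le_iff order_less_imp_le)
    then show ?thesis unfolding g_def
      using that y0 by (intro block_value_nonneg[where s = s] N c N_nonneg c_nonneg) auto
  qed
  show ?thesis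
    using g0 step m_nonneg b_nonneg \<open>i < d\<close> by (intro lag_term_summable[where g = g]) auto
qed

text \<open>Conversely, let \<open>w\<close> be the vector of moduli of an eigenvector to an eigenvalue of modulus at
  least 1. The homogeneous recursion started from \<open>w\<close> does not fall below \<open>w\<close> after whole periods,
  although it is dominated by the tails of a convergent series as soon as the sum of the series has
  positive components.\<close>

lemma spectral_radius_of_summable:
  assumes sm: "\<And>t i. i < d \<Longrightarrow> summable (\<lambda>k. lag_term d m b k t i)"
    and pos: "\<And>i. i < d \<Longrightarrow> 0 < (\<Sum>k. lag_term d m b k 0 i)"
  shows "spectral_radius (map_mat complex_of_real monodromy) < 1"
proof (rule ccontr)
  assume large: "\<not> ?thesis"
  let ?F = "map_mat complex_of_real monodromy"
  have F: "?F \<in> carrier_mat d d" using monodromy_carrier by simp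
  obtain ev where ev: "ev \<in> spectrum ?F" "1 \<le> norm ev"
    using spectral_radius_mem_max(1)[OF F d] large by auto
  then obtain z where "eigenvector ?F z ev"
    by (auto simp: spectrum_def eigenvalue_def)
  then have z: "z \<in> carrier_vec d" "z \<noteq> 0\<^sub>v d" "?F *\<^sub>v z = ev \<cdot>\<^sub>v z"
    using F by (auto simp: eigenvector_def)
  define w where "w i = norm (z $ i)" for i
  have Fnn: "0 \<le> monodromy $$ (i, j)" if "i < d" "j < d" for i j
    using that by (intro mat_prod_nonneg[where s = s] N N_nonneg) auto
  have w: "w i \<le> (\<Sum>j<d. monodromy $$ (i, j) * w j)" if "i < d" for i
  proof -
    have "1 * w i \<le> norm ev * w i" using ev by (intro mult_right_mono) (auto simp: w_def)
    also have "\<dots> = norm ((?F *\<^sub>v z) $ i)"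
      using z that by (simp add: w_def norm_mult)
    also have "(?F *\<^sub>v z) $ i = (\<Sum>j<d. ?F $$ (i, j) * z $ j)"
      using F z that by (subst mult_mat_vec_component) auto
    also have "norm \<dots> \<le> (\<Sum>j<d. monodromy $$ (i, j) * w j)"
      using monodromy_carrier that Fnn
      by (intro order_trans[OF norm_sum sum_mono]) (auto simp: norm_mult w_def)
    finally show ?thesis by simp
  qed
  \<comment> \<open>the homogeneous recursion started from \<open>w\<close> at time 0\<close>
  define u where "u = rec_nat w (\<lambda>n x i. \<Sum>j<d. m (int (Suc n)) i j * x j)"
  have u0: "u 0 = w" and uSuc: "u (Suc n) i = (\<Sum>j<d. m (int (Suc n)) i j * u n j)" for n i
    by (simp_all add: u_def)
  have block: "u (s * n + v) i = block_value d N (\<lambda>_. 0\<^sub>v d) (Matrix.vec d (u (s * n))) v i"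
    if "v \<le> s" "i < d" for n v i
    using that
  proof (induction v arbitrary: i)
    case 0
    then show ?case by (simp add: block_value_0)
  next
    case (Suc v)
    have "season s (int (Suc (s * n + v))) = Suc v"
      using season_eq[of v s "int n"] Suc.prems by (simp add: algebra_simps)
    then show ?case
      using Suc uSuc[of "s * n + v" i] by (simp add: block_value_Suc[OF N])
  qed
  have ge: "w i \<le> u (s * n) i" if "i < d" for n i
    using that
  proof (induction n arbitrary: i)
    case 0
    then show ?case by (simp add: u0)
  next
    case (Suc n)
    have "w i \<le> (\<Sum>j<d. monodromy $$ (i, j) * w j)" using w Suc.prems by simp
    also have "\<dots> \<le> (\<Sum>j<d. monodromy $$ (i, j) * u (s * n) j)"
      using Suc by (intro sum_mono mult_left_mono Fnn) auto
    also have "\<dots> = u (s * n + s) i"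
      using Suc.prems by (simp add: block[OF order_refl] block_value_eq_add[OF N] block_value_zero[OF N])
    finally show ?case by (simp add: algebra_simps)
  qed
  \<comment> \<open>large enough for \<open>w\<close> to be at most \<open>C\<close> times the sum of the lag terms in every component\<close>
  define C where "C = (\<Sum>i<d. w i / (\<Sum>k. lag_term d m b k 0 i))"
  have C0: "u 0 i \<le> C * (\<Sum>k. lag_term d m b k 0 i)" if "i < d" for i
  proof -
    have "w i / (\<Sum>k. lag_term d m b k 0 i) \<le> C"
      unfolding C_def using that pos
      by (intro member_le_sum) (auto simp: w_def intro!: divide_nonneg_pos)
    then show ?thesis using pos[OF that] by (simp add: u0 pos_divide_le_eq)
  qed
  have tail: "w i \<le> C * (\<Sum>k. lag_term d m b (k + s * n) 0 i)" if "i < d" for i n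
  proof -
    have "w i \<le> u (s * n) i" using ge that by simp
    also have "\<dots> \<le> C * (\<Sum>k. lag_term d m b (k + s * n) (0 + int (s * n)) i)"
      using that m_nonneg sm C0 uSuc by (intro homogeneous_le_tail[where m = m]) auto
    also have "(\<lambda>k. lag_term d m b (k + s * n) (0 + int (s * n)) i)
        = (\<lambda>k. lag_term d m b (k + s * n) 0 i)"
      using lag_term_shift[of d m "int (s * n)" b _ 0 i]
      by (simp add: season_add_period fun_eq_iff)
    finally show ?thesis .
  qed
  have "w i \<le> 0" if "i < d" for i
  proof (rule LIMSEQ_le_const)
    have "(\<lambda>n. \<Sum>k. lag_term d m b (k + n) 0 i) \<longlonglongrightarrow> 0"
      by (rule suminf_exist_split2[OF sm[OF that]])
    then have "(\<lambda>n. \<Sum>k. lag_term d m b (k + s * n) 0 i) \<longlonglongrightarrow> 0"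
      by (rule filterlim_compose) (use s in \<open>auto intro!: filterlim_subseq strict_monoI\<close>)
    then show "(\<lambda>n. C * (\<Sum>k. lag_term d m b (k + s * n) 0 i)) \<longlonglongrightarrow> 0"
      by (rule tendsto_mult_right_zero)
    show "\<exists>n0. \<forall>n\<ge>n0. w i \<le> C * (\<Sum>k. lag_term d m b (k + s * n) 0 i)"
      using tail[OF that] by blast
  qed
  then have "z = 0\<^sub>v d" using z(1) by (intro eq_vecI) (auto simp: w_def)
  with z(2) show False ..
qed

end

section \<open>The periodic GARCH recursion\<close>

lemma pgarch_phi_carrier: "pgarch_phi p q alpha beta v u \<in> carrier_mat (p + q) (p + q)"
  by (auto simp: pgarch_phi_def)

lemma pgarch_b_carrier: "pgarch_b p q alpha v u \<in> carrier_vec (p + q)"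
  by (simp add: pgarch_b_def)

text \<open>The entries of the coefficient matrix and of the inhomogeneity as functions of the single
  value \<open>x\<close> of \<open>\<eta>\<close> on which they depend. Row 0 updates the squared observation and row \<open>p\<close> the
  volatility; the other rows shift the history.\<close>

definition phi_entry ::
  "nat \<Rightarrow> (nat \<Rightarrow> nat \<Rightarrow> real) \<Rightarrow> (nat \<Rightarrow> nat \<Rightarrow> real) \<Rightarrow> nat \<Rightarrow> real \<Rightarrow> nat \<Rightarrow> nat \<Rightarrow> real"
where
  "phi_entry p alpha beta v x i j =
     (let w = (if j < p then alpha (j + 1) v else beta (j - p + 1) v) in
        if i = 0 then w * x else if i = p then w else if i = j + 1 then 1 else 0)"

definition b_entry :: "nat \<Rightarrow> (nat \<Rightarrow> nat \<Rightarrow> real) \<Rightarrow> nat \<Rightarrow> real \<Rightarrow> nat \<Rightarrow> real" where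
  "b_entry p alpha v x i = (if i = 0 then alpha 0 v * x else if i = p then alpha 0 v else 0)"

lemma pgarch_phi_eq_entry:
  assumes "1 \<le> p" "i < p + q" "j < p + q"
  shows "pgarch_phi p q alpha beta v u $$ (i, j) = phi_entry p alpha beta v (u $ (v - 1)) i j"
  using assms by (auto simp: pgarch_phi_def phi_entry_def Let_def)

lemma pgarch_b_eq_entry:
  assumes "i < p + q"
  shows "pgarch_b p q alpha v u $ i = b_entry p alpha v (u $ (v - 1)) i"
  using assms by (auto simp: pgarch_b_def b_entry_def)

lemma block_index_less:
  fixes d s v i :: nat
  assumes "v < s" "i < d"
  shows "d * v + i < d * s"
proof -
  have "d * v + i < d * Suc v" using assms by simp
  also have "\<dots> \<le> d * s" using assms by (intro mult_le_mono2) simp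
  finally show ?thesis .
qed

lemma index_div_mod_less:
  fixes k d s :: nat
  assumes "k < d * s"
  shows "k div d < s" "k mod d < d" "d * (k div d) + k mod d = k"
proof -
  have "0 < d" using assms by (cases d) auto
  with assms show "k div d < s" "k mod d < d" "d * (k div d) + k mod d = k"
    by (auto simp: less_mult_imp_div_less mult.commute)
qed

text \<open>The equation for one whole period is equivalent to \<open>s\<close> consecutive steps of the
  \<open>p + q\<close>-dimensional recursion.\<close>

lemma pgarch_equation_iff:
  assumes s: "1 \<le> s" and d: "0 < p + q"
    and Y: "Y \<in> carrier_vec ((p + q) * s)" and Y': "Y' \<in> carrier_vec ((p + q) * s)"
  shows "Y = pgarch_A s p q alpha beta u *\<^sub>v Y' + pgarch_B s p q alpha beta u \<longleftrightarrow>
    (\<forall>v<s. \<forall>i<p + q. Y $ ((p + q) * v + i) = pgarch_b p q alpha (Suc v) u $ i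
       + (\<Sum>j<p + q. pgarch_phi p q alpha beta (Suc v) u $$ (i, j)
            * (if v = 0 then Y' $ ((p + q) * (s - 1) + j) else Y $ ((p + q) * (v - 1) + j))))"
    (is "Y = ?R \<longleftrightarrow> ?rec")
proof -
  define d where "d = p + q"
  define N where "N v = pgarch_phi p q alpha beta v u" for v
  define c where "c v = pgarch_b p q alpha v u" for v
  define x where "x = Matrix.vec d (\<lambda>j. Y' $ (d * (s - 1) + j))"
  have N: "N v \<in> carrier_mat d d" and c: "c v \<in> carrier_vec d" for v
    by (auto simp: N_def c_def d_def pgarch_phi_carrier pgarch_b_carrier)
  have x: "x \<in> carrier_vec d" by (simp add: x_def)
  have d0: "0 < d" using d by (simp add: d_def)
  have dimB: "dim_vec (pgarch_B s p q alpha beta u) = d * s"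
    by (simp add: pgarch_B_def Let_def d_def)
  have R: "?R \<in> carrier_vec (d * s)"
    by (rule carrier_vecI) (simp add: dimB)
  have entry: "?R $ (d * v + i) = block_value d N c x (Suc v) i" if v: "v < s" and i: "i < d" for v i
  proof -
    let ?P = "mat_prod d (\<lambda>l. N (Suc v - l)) (Suc v)"
    have P: "?P \<in> carrier_mat d d" by (intro mat_prod_carrier N)
    have dm: "(d * v + i) div d = v" "(d * v + i) mod d = i" using i by auto
    have less: "d * v + i < d * s" by (rule block_index_less[OF v i])
    have row: "pgarch_A s p q alpha beta u $$ (d * v + i, j)
        = (if j div d = s - 1 then ?P $$ (i, j mod d) else 0)" if "j < d * s" for j
      using less that dm by (simp add: pgarch_A_def Let_def d_def[symmetric] N_def)
    have dimA: "dim_row (pgarch_A s p q alpha beta u) = d * s"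
        "dim_col (pgarch_A s p q alpha beta u) = d * s"
      by (simp_all add: pgarch_A_def Let_def d_def)
    have dimY': "dim_vec Y' = d * s" using Y' by (simp add: d_def)
    have last: "d * s = d * (s - 1) + d" using s by (cases s) auto
    have "(pgarch_A s p q alpha beta u *\<^sub>v Y') $ (d * v + i)
        = (\<Sum>j<d * s. (if j div d = s - 1 then ?P $$ (i, j mod d) else 0) * Y' $ j)"
      using less dimA dimY' by (simp add: mult_mat_vec_component row)
    also have "\<dots> = (\<Sum>j\<in>{d * (s - 1)..<d * (s - 1) + d}. ?P $$ (i, j mod d) * Y' $ j)"
    proof (rule sum.mono_neutral_cong_right)
      have "j div d = s - 1" if "d * (s - 1) \<le> j" "j < d * (s - 1) + d" for j
        using that d0 by (intro div_nat_eqI) (auto simp: algebra_simps)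
      moreover have "d * (s - 1) \<le> j \<and> j < d * (s - 1) + d" if "j div d = s - 1" for j
        using that d0 times_div_less_eq_dividend[of d j] dividend_less_times_div[of d j] by auto
      ultimately show "\<forall>j\<in>{..<d * s} - {d * (s - 1)..<d * (s - 1) + d}.
          (if j div d = s - 1 then ?P $$ (i, j mod d) else 0) * Y' $ j = 0"
        and "\<And>j. j \<in> {d * (s - 1)..<d * (s - 1) + d} \<Longrightarrow>
          (if j div d = s - 1 then ?P $$ (i, j mod d) else 0) * Y' $ j = ?P $$ (i, j mod d) * Y' $ j"
        by auto
    qed (auto simp: last)
    also have "\<dots> = (\<Sum>j<d. ?P $$ (i, j) * Y' $ (d * (s - 1) + j))"
      by (subst sum.atLeastLessThan_shift_0) (auto simp: atLeast0LessThan intro!: sum.cong)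
    also have "\<dots> = (?P *\<^sub>v x) $ i"
      using P i by (simp add: mult_mat_vec_component x_def)
    finally have A: "(pgarch_A s p q alpha beta u *\<^sub>v Y') $ (d * v + i) = (?P *\<^sub>v x) $ i" .
    have B: "pgarch_B s p q alpha beta u $ (d * v + i)
        = (\<Sum>k = 1..Suc v. (mat_prod d (\<lambda>l. N (Suc v - l)) (Suc v - k) *\<^sub>v c k) $ i)"
      using less dm by (simp add: pgarch_B_def Let_def d_def[symmetric] N_def c_def del: sum.cl_ivl_Suc)
    have "?R $ (d * v + i) = (pgarch_A s p q alpha beta u *\<^sub>v Y') $ (d * v + i)
        + pgarch_B s p q alpha beta u $ (d * v + i)"
      using less dimB by simp
    then show ?thesis unfolding block_value_def A B .
  qed
  let ?step = "\<lambda>v i. c (Suc v) $ i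
      + (\<Sum>j<d. N (Suc v) $$ (i, j) * (if v = 0 then x $ j else Y $ (d * (v - 1) + j)))"
  have rec_iff: "?rec \<longleftrightarrow> (\<forall>v<s. \<forall>i<d. Y $ (d * v + i) = ?step v i)"
    unfolding d_def[symmetric] by (simp add: N_def c_def x_def cong: if_cong)
  have "Y = ?R \<longleftrightarrow> (\<forall>v<s. \<forall>i<d. Y $ (d * v + i) = block_value d N c x (Suc v) i)"
  proof
    assume "Y = ?R"
    then show "\<forall>v<s. \<forall>i<d. Y $ (d * v + i) = block_value d N c x (Suc v) i"
      using entry by metis
  next
    assume *: "\<forall>v<s. \<forall>i<d. Y $ (d * v + i) = block_value d N c x (Suc v) i"
    have "Y $ k = ?R $ k" if "k < d * s" for k
      using entry[OF index_div_mod_less(1,2)[OF that]] * index_div_mod_less[OF that] by metis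
    moreover have "dim_vec ?R = d * s" "dim_vec Y = d * s"
      using Y dimB by (simp_all add: d_def)
    ultimately show "Y = ?R" by (simp only: eq_vecI)
  qed
  also have "\<dots> \<longleftrightarrow> (\<forall>v<s. \<forall>i<d. Y $ (d * v + i) = ?step v i)"
  proof (intro iffI allI impI)
    fix v i assume *: "\<forall>v<s. \<forall>i<d. Y $ (d * v + i) = block_value d N c x (Suc v) i"
      and "v < s" "i < d"
    have "block_value d N c x v j = (if v = 0 then x $ j else Y $ (d * (v - 1) + j))"
      if "j < d" for j
      using * \<open>v < s\<close> that x by (cases v) (auto simp: block_value_0)
    then show "Y $ (d * v + i) = ?step v i"
      using * \<open>v < s\<close> \<open>i < d\<close> by (simp add: block_value_Suc[OF N c x])
  next
    fix v i assume *: "\<forall>v<s. \<forall>i<d. Y $ (d * v + i) = ?step v i" and "v < s" "i < d"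
    show "Y $ (d * v + i) = block_value d N c x (Suc v) i"
      using \<open>v < s\<close> \<open>i < d\<close>
    proof (induction v arbitrary: i)
      case 0
      then show ?case
        using *[rule_format, of 0 i] x by (simp add: block_value_Suc[OF N c x] block_value_0)
    next
      case (Suc v)
      then have "Y $ (d * Suc v + i) = ?step (Suc v) i" using * by blast
      also have "\<dots> = block_value d N c x (Suc (Suc v)) i"
        using Suc by (simp add: block_value_Suc[OF N c x, where v = "Suc v"])
      finally show ?case .
    qed
  qed
  finally show ?thesis using rec_iff by simp
qed

section \<open>Factors of independent sequences\<close>

lemma mem_invariant_iff:
  assumes "g -` T \<inter> S = T" "x \<in> S"
  shows "g x \<in> T \<longleftrightarrow> x \<in> T"
proof -
  have "x \<in> g -` T \<inter> S \<longleftrightarrow> g x \<in> T" using assms(2) by simp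
  then show ?thesis using assms(1) by simp
qed

lemma measurable_PiM_UNIV:
  assumes "\<And>i. f i \<in> M \<rightarrow>\<^sub>M N i"
  shows "(\<lambda>\<omega> i. f i \<omega>) \<in> M \<rightarrow>\<^sub>M Pi\<^sub>M UNIV N"
  using measurable_restrict[of UNIV f M N] assms by (simp add: restrict_UNIV)

lemma measurable_shift:
  "(\<lambda>(e :: int \<Rightarrow> 'b) t. e (t + h)) \<in> Pi\<^sub>M UNIV (\<lambda>_. N) \<rightarrow>\<^sub>M Pi\<^sub>M UNIV (\<lambda>_. N)"
  by (rule measurable_PiM_UNIV) simp

text \<open>Independent identically distributed sequences indexed by the integers, in the canonical
  representation as a product measure.\<close>

locale iid_paths = prob_space D for D :: "'b measure"
begin

abbreviation paths :: "(int \<Rightarrow> 'b) measure" where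
  "paths \<equiv> Pi\<^sub>M UNIV (\<lambda>_. D)"

abbreviation shift :: "int \<Rightarrow> (int \<Rightarrow> 'b) \<Rightarrow> (int \<Rightarrow> 'b)" where
  "shift h \<equiv> \<lambda>e t. e (t + h)"

sublocale product: product_prob_space "\<lambda>_ :: int. D" UNIV
  by unfold_locales

lemma distr_shift: "distr paths paths (shift h) = paths"
  using distr_PiM_reindex[of UNIV "\<lambda>_. D" "\<lambda>t. t + h" UNIV] prob_space_axioms
  by (simp add: inj_on_def restrict_UNIV)

lemma measure_shift:
  assumes "B \<in> sets paths"
  shows "measure paths (shift h -` B \<inter> space paths) = measure paths B"
  using assms by (subst (2) distr_shift[of h, symmetric]) (simp add: measure_distr measurable_shift)

text \<open>Mixing: distant cylinders depend on disjoint sets of coordinates, and the class of events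
  that are asymptotically independent of the shifts of a fixed cylinder is a Dynkin system.\<close>

lemma mixing_cylinder:
  assumes s: "1 \<le> s" and A: "A \<in> sets paths" and B: "B \<in> prod_algebra UNIV (\<lambda>_. D)"
  shows "(\<lambda>n. measure paths (A \<inter> (shift (int s * int n) -` B \<inter> space paths)))
           \<longlonglongrightarrow> measure paths A * measure paths B"
proof -
  define C where "C n = shift (int s * int n) -` B \<inter> space paths" for n
  have B': "B \<in> sets paths" using B by (simp add: sets_PiM)
  have C: "C n \<in> sets paths" for n
    unfolding C_def by (rule measurable_sets[OF measurable_shift B'])
  have mC: "measure paths (C n) = measure paths B" for n
    unfolding C_def by (rule measure_shift[OF B'])
  have A': "A \<in> sigma_sets (space paths) (prod_algebra UNIV (\<lambda>_. D))"
    using A by (simp add: sets_PiM space_PiM)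
  have *: "sigma_sets (space paths) (prod_algebra UNIV (\<lambda>_. D)) = sets paths"
    by (simp add: sets_PiM space_PiM)
  have closed: "prod_algebra UNIV (\<lambda>_. D) \<subseteq> Pow (space paths)"
    using prod_algebra_sets_into_space[of UNIV "\<lambda>_. D"] by (simp add: space_PiM)
  have "(\<lambda>n. measure paths (A \<inter> C n)) \<longlonglongrightarrow> measure paths A * measure paths B"
    using Int_stable_prod_algebra closed A'
  proof (induction rule: sigma_sets_induct_disjoint)
    case (basic A)
    from prod_algebraE[OF basic] obtain J E where J: "finite J"
      "A = prod_emb UNIV (\<lambda>_. D) J (Pi\<^sub>E J E)" "\<And>i. i \<in> J \<Longrightarrow> E i \<in> sets D"
      by metis
    from prod_algebraE[OF B] obtain J' E' where J': "finite J'"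
      "B = prod_emb UNIV (\<lambda>_. D) J' (Pi\<^sub>E J' E')" "\<And>i. i \<in> J' \<Longrightarrow> E' i \<in> sets D"
      by metis
    have mA: "measure paths A = (\<Prod>i\<in>J. measure D (E i))"
      and mB: "measure paths B = (\<Prod>i\<in>J'. measure D (E' i))"
      unfolding J(2) J'(2) using J J' by (auto intro!: product.measure_PiM_emb)
    \<comment> \<open>a shift by more than the distance of any two points of \<open>J \<union> J'\<close> separates the coordinates\<close>
    define n0 where "n0 = nat (\<Sum>i\<in>J \<union> J'. 2 * \<bar>i\<bar>) + 1"
    have "measure paths (A \<inter> C n) = measure paths A * measure paths B" if "n0 \<le> n" for n
    proof -
      define k where "k = int s * int n"
      have "int n0 \<le> int n" using that by simp
      also have "int n \<le> int s * int n" using s by (simp add: mult_le_cancel_right1)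
      finally have k: "int n0 \<le> k" by (simp add: k_def)
      have bound: "2 * \<bar>i\<bar> < int n0" if "i \<in> J \<union> J'" for i
      proof -
        have "2 * \<bar>i\<bar> \<le> (\<Sum>i\<in>J \<union> J'. 2 * \<bar>i\<bar>)"
          using that J(1) J'(1) by (intro member_le_sum) auto
        moreover have "0 \<le> (\<Sum>i\<in>J \<union> J'. 2 * \<bar>i\<bar>)" by (intro sum_nonneg) simp
        ultimately show ?thesis by (simp add: n0_def)
      qed
      define K where "K = (\<lambda>i. i + k) ` J'"
      have disj: "J \<inter> K = {}"
      proof (rule equals0I)
        fix j assume "j \<in> J \<inter> K"
        then obtain i where "i \<in> J'" "j = i + k" "j \<in> J" by (auto simp: K_def)
        with bound[of i] bound[of j] k show False by auto
      qed
      define F where "F i = (if i \<in> J then E i else E' (i - k))" for i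
      have F: "F i \<in> sets D" if "i \<in> J \<union> K" for i
        using that J J' by (auto simp: F_def K_def)
      have "A \<inter> C n = prod_emb UNIV (\<lambda>_. D) (J \<union> K) (Pi\<^sub>E (J \<union> K) F)"
      proof (rule Set.set_eqI)
        fix e :: "int \<Rightarrow> 'b"
        have "(\<forall>i\<in>J \<union> K. e i \<in> F i) \<longleftrightarrow> (\<forall>i\<in>J. e i \<in> E i) \<and> (\<forall>i\<in>K. e i \<in> E' (i - k))"
          using disj by (auto simp: F_def)
        moreover have "(\<forall>i\<in>K. e i \<in> E' (i - k)) \<longleftrightarrow> (\<forall>i\<in>J'. e (i + k) \<in> E' i)"
          by (simp add: K_def)
        ultimately show "e \<in> A \<inter> C n \<longleftrightarrow> e \<in> prod_emb UNIV (\<lambda>_. D) (J \<union> K) (Pi\<^sub>E (J \<union> K) F)"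
          by (auto simp: J(2) J'(2) C_def k_def[symmetric] prod_emb_def space_PiM PiE_iff)
      qed
      then have "measure paths (A \<inter> C n) = (\<Prod>i\<in>J \<union> K. measure D (F i))"
        using F J(1) J'(1) by (simp only:, intro product.measure_PiM_emb) (auto simp: K_def)
      also have "\<dots> = (\<Prod>i\<in>J. measure D (F i)) * (\<Prod>i\<in>K. measure D (F i))"
        using J(1) J'(1) disj by (intro prod.union_disjoint) (auto simp: K_def)
      also have "(\<Prod>i\<in>J. measure D (F i)) = measure paths A"
        unfolding mA by (intro prod.cong) (auto simp: F_def)
      also have "(\<Prod>i\<in>K. measure D (F i)) = (\<Prod>i\<in>K. measure D (E' (i - k)))"
        using disj by (intro prod.cong) (auto simp: F_def)
      also have "\<dots> = measure paths B"
        unfolding mB K_def by (subst prod.reindex) (auto simp: inj_on_def)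
      finally show ?thesis .
    qed
    then show ?case
      by (intro tendsto_eventually eventually_sequentiallyI[of n0]) auto
  next
    case empty
    then show ?case by simp
  next
    case (compl A)
    then have A: "A \<in> sets paths" using * by simp
    have "measure paths ((space paths - A) \<inter> C n) = measure paths B - measure paths (A \<inter> C n)" for n
    proof -
      have "(space paths - A) \<inter> C n = C n - A \<inter> C n"
        using sets.sets_into_space[OF C[of n]] by auto
      then show ?thesis
        using A C[of n] by (simp add: product.P.finite_measure_Diff mC)
    qed
    moreover have "(\<lambda>n. measure paths B - measure paths (A \<inter> C n))
        \<longlonglongrightarrow> measure paths B - measure paths A * measure paths B"
      by (intro tendsto_intros compl.IH)
    ultimately have "(\<lambda>n. measure paths ((space paths - A) \<inter> C n))
        \<longlonglongrightarrow> measure paths B - measure paths A * measure paths B"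
      by (simp only:)
    then show ?case
      using A by (simp add: product.P.prob_compl left_diff_distrib)
  next
    case (union A)
    then have A: "A i \<in> sets paths" for i using * by auto
    have sums: "(\<lambda>i. measure paths (A i)) sums measure paths (\<Union>i. A i)"
      using A union(1) by (intro product.P.finite_measure_UNION) auto
    have "(\<lambda>i. measure paths (A i \<inter> C n)) sums measure paths (\<Union>i. A i \<inter> C n)" for n
      using A C[of n] union(1)
      by (intro product.P.finite_measure_UNION) (auto simp: disjoint_family_on_def)
    then have split: "measure paths ((\<Union>i. A i) \<inter> C n) = (\<Sum>i. measure paths (A i \<inter> C n))" for n
      by (metis UN_extend_simps(4) sums_unique)
    have "(\<lambda>n. \<Sum>i. measure paths (A i \<inter> C n)) \<longlonglongrightarrow> (\<Sum>i. measure paths (A i) * measure paths B)"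
    proof (rule tannerys_theorem[THEN conjunct2, THEN conjunct2])
      show "\<And>i. (\<lambda>n. measure paths (A i \<inter> C n)) \<longlonglongrightarrow> measure paths (A i) * measure paths B"
        by (rule union.IH)
      show "summable (\<lambda>i. measure paths (A i))" using sums by (rule sums_summable)
      show "\<forall>\<^sub>F (i, n) in at_top \<times>\<^sub>F at_top. norm (measure paths (A i \<inter> C n)) \<le> measure paths (A i)"
        using A C by (intro always_eventually) (auto intro!: product.P.finite_measure_mono)
    qed auto
    moreover have "(\<Sum>i. measure paths (A i) * measure paths B) = measure paths (\<Union>i. A i) * measure paths B"
      using sums_mult2[OF sums] by (rule sums_unique[symmetric])
    ultimately show ?case by (simp add: split)
  qed
  then show ?thesis by (simp add: C_def)
qed

lemma invariant_event_trivial: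
  assumes s: "1 \<le> s" and T: "T \<in> sets paths" and inv: "shift (int s) -` T \<inter> space paths = T"
  shows "measure paths T \<in> {0, 1}"
proof -
  have inv_n: "shift (int s * int n) -` T \<inter> space paths = T" for n
  proof (induction n)
    case 0
    then show ?case using sets.sets_into_space[OF T] by auto
  next
    case (Suc n)
    have "e \<in> T \<longleftrightarrow> shift (int s * int (Suc n)) e \<in> T" if e: "e \<in> space paths" for e
    proof -
      have "shift (int s * int n) e \<in> space paths"
        using measurable_space[OF measurable_shift e] .
      then have "shift (int s) (shift (int s * int n) e) \<in> T \<longleftrightarrow> shift (int s * int n) e \<in> T"
        by (rule mem_invariant_iff[OF inv])
      also have "\<dots> \<longleftrightarrow> e \<in> T" by (rule mem_invariant_iff[OF Suc.IH e])
      finally show ?thesis by (simp add: algebra_simps)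
    qed
    then show ?case using sets.sets_into_space[OF T] by auto
  qed
  have indep: "measure paths (T \<inter> B) = measure paths T * measure paths B"
    if B: "B \<in> prod_algebra UNIV (\<lambda>_. D)" for B
  proof -
    have B': "B \<in> sets paths" using B by (simp add: sets_PiM)
    \<comment> \<open>the sequence in the mixing property is constant, as \<open>T\<close> is invariant\<close>
    have "measure paths (T \<inter> (shift (int s * int n) -` B \<inter> space paths)) = measure paths (T \<inter> B)" for n
    proof -
      have "T \<inter> (shift (int s * int n) -` B \<inter> space paths)
          = shift (int s * int n) -` (T \<inter> B) \<inter> space paths"
        by (subst inv_n[of n, symmetric]) auto
      then show ?thesis using measure_shift[of "T \<inter> B"] T B' by simp
    qed
    with mixing_cylinder[OF s T B] show ?thesis
      by (simp add: LIMSEQ_const_iff)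
  qed
  \<comment> \<open>\<open>T\<close> is independent of all cylinders, hence of the events that they generate, hence of itself\<close>
  have "product.P.indep_set {T} (prod_algebra UNIV (\<lambda>_. D))"
    using T indep by (intro product.P.indep_setI) (auto simp: sets_PiM)
  then have indep_T: "product.P.indep_set (sigma_sets (space paths) {T})
      (sigma_sets (space paths) (prod_algebra UNIV (\<lambda>_. D)))"
  proof (rule product.P.indep_set_sigma_sets)
    show "Int_stable {T}" by (simp add: Int_stable_def)
  qed (rule Int_stable_prod_algebra)
  have T_generated: "T \<in> sigma_sets (space paths) (prod_algebra UNIV (\<lambda>_. D))"
    using T by (simp add: sets_PiM space_PiM)
  have "measure paths (T \<inter> T) = measure paths T * measure paths T"
    by (rule product.P.indep_setD[OF indep_T _ T_generated]) simp
  then show ?thesis by simp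
qed

end

text \<open>A process that is obtained from an independent identically distributed sequence by applying
  one and the same function to its shifts inherits stationarity and ergodicity.\<close>

lemma factor_of_iid_ergodic:
  fixes eta :: "int \<Rightarrow> 'a \<Rightarrow> 'b"
  assumes M: "prob_space M" and eta: "\<And>t. eta t \<in> M \<rightarrow>\<^sub>M E"
    and D: "prob_space D" "sets D = sets E"
    and law: "distr M (Pi\<^sub>M UNIV (\<lambda>_. E)) (\<lambda>\<omega> t. eta t \<omega>) = Pi\<^sub>M UNIV (\<lambda>_. D)"
    and s: "1 \<le> s"
    and f: "f \<in> Pi\<^sub>M UNIV (\<lambda>_. E) \<rightarrow>\<^sub>M N"
  shows "ergodic_process M N (\<lambda>t \<omega>. f (\<lambda>r. eta (r + int s * t) \<omega>))"
proof -
  interpret D: iid_paths D using D(1) by (simp add: iid_paths_def)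
  let ?E = "Pi\<^sub>M (UNIV :: int set) (\<lambda>_. E)"
  let ?N = "Pi\<^sub>M (UNIV :: int set) (\<lambda>_. N)"
  let ?path = "\<lambda>\<omega> t. eta t \<omega>"
  have sets_eq: "sets D.paths = sets ?E" using D(2) by (intro sets_PiM_cong) auto
  define G where "G e = (\<lambda>t. f (\<lambda>r. e (r + int s * t)))" for e
  have "G \<in> ?E \<rightarrow>\<^sub>M ?N"
    unfolding G_def by (intro measurable_PiM_UNIV measurable_compose[OF measurable_shift f])
  then have G: "G \<in> D.paths \<rightarrow>\<^sub>M ?N"
    by (simp only: measurable_cong_sets[OF sets_eq refl])
  have path: "?path \<in> M \<rightarrow>\<^sub>M ?E" by (intro measurable_PiM_UNIV eta)
  then have path': "?path \<in> M \<rightarrow>\<^sub>M D.paths"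
    by (simp only: measurable_cong_sets[OF refl sets_eq])
  have law': "distr M D.paths ?path = D.paths"
    using law by (simp only: distr_cong[OF refl sets_eq refl])
  have X: "(\<lambda>t. f (\<lambda>r. eta (r + int s * (t + h)) \<omega>)) = G (D.shift (int s * h) (?path \<omega>))" for h \<omega>
    by (simp add: G_def algebra_simps)
  have law_h: "distr M ?N (\<lambda>\<omega> t. f (\<lambda>r. eta (r + int s * (t + h)) \<omega>)) = distr D.paths ?N G" for h
  proof -
    have "distr M ?N (\<lambda>\<omega>. G (D.shift (int s * h) (?path \<omega>)))
        = distr (distr (distr M D.paths ?path) D.paths (D.shift (int s * h))) ?N G"
      by (simp add: distr_distr[OF G measurable_compose[OF path' measurable_shift]]
            distr_distr[OF measurable_shift path'] comp_def del: law')
    then show ?thesis unfolding X law' D.distr_shift .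
  qed
  have stat: "strictly_stationary M N (\<lambda>t \<omega>. f (\<lambda>r. eta (r + int s * t) \<omega>))"
    unfolding strictly_stationary_def using law_h law_h[of 0] by simp
  have "measure M {\<omega> \<in> space M. (\<lambda>t. f (\<lambda>r. eta (r + int s * t) \<omega>)) \<in> S} \<in> {0, 1}"
    if S: "S \<in> sets ?N" and inv: "(\<lambda>y t. y (t + 1)) -` S \<inter> space ?N = S" for S
  proof -
    define T where "T = G -` S \<inter> space D.paths"
    have T: "T \<in> sets D.paths" unfolding T_def by (rule measurable_sets[OF G S])
    have "{\<omega> \<in> space M. (\<lambda>t. f (\<lambda>r. eta (r + int s * t) \<omega>)) \<in> S} = ?path -` T \<inter> space M"
      using measurable_space[OF path'] by (auto simp: T_def G_def)
    then have "measure M {\<omega> \<in> space M. (\<lambda>t. f (\<lambda>r. eta (r + int s * t) \<omega>)) \<in> S} = measure D.paths T"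
      using measure_distr[OF path' T] by (simp add: law')
    moreover have "D.shift (int s) -` T \<inter> space D.paths = T"
    proof -
      have "G (D.shift (int s) e) \<in> S \<longleftrightarrow> G e \<in> S" if "e \<in> space D.paths" for e
      proof -
        have "G (D.shift (int s) e) = (\<lambda>t. G e (t + 1))"
          by (simp add: G_def algebra_simps)
        then show ?thesis
          using mem_invariant_iff[OF inv measurable_space[OF G that]] by simp
      qed
      then show ?thesis
        using measurable_space[OF measurable_shift, of _ D "int s"] by (auto simp: T_def)
    qed
    ultimately show ?thesis using D.invariant_event_trivial[OF s T] by simp
  qed
  with stat show ?thesis unfolding ergodic_process_def by blast
qed

section \<open>Linear recursions with independent random coefficients\<close>

text \<open>Here \<open>a t\<close> and \<open>b t\<close> give the coefficient matrix and the inhomogeneity at time \<open>t\<close> as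
  functions of the noise value at that time; \<open>a_mean\<close> and \<open>b_mean\<close> are their expectations.\<close>

locale random_recursion = prob_space M for M :: "'a measure" +
  fixes eta :: "int \<Rightarrow> 'a \<Rightarrow> real" and d :: nat
    and a :: "int \<Rightarrow> real \<Rightarrow> nat \<Rightarrow> nat \<Rightarrow> real" and a_mean :: "int \<Rightarrow> nat \<Rightarrow> nat \<Rightarrow> real"
    and b :: "int \<Rightarrow> real \<Rightarrow> nat \<Rightarrow> real" and b_mean :: "int \<Rightarrow> nat \<Rightarrow> real"
  assumes indep: "indep_vars (\<lambda>_. borel) eta UNIV"
    and a_measurable: "\<And>t i j. i < d \<Longrightarrow> j < d \<Longrightarrow> (\<lambda>x. a t x i j) \<in> borel_measurable borel"
    and a_nonneg: "\<And>t x i j. i < d \<Longrightarrow> j < d \<Longrightarrow> 0 \<le> a t x i j"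
    and a_integrable: "\<And>t i j. i < d \<Longrightarrow> j < d \<Longrightarrow> integrable M (\<lambda>\<omega>. a t (eta t \<omega>) i j)"
    and a_mean: "\<And>t i j. i < d \<Longrightarrow> j < d \<Longrightarrow> (\<integral>\<omega>. a t (eta t \<omega>) i j \<partial>M) = a_mean t i j"
    and b_measurable: "\<And>t i. i < d \<Longrightarrow> (\<lambda>x. b t x i) \<in> borel_measurable borel"
    and b_nonneg: "\<And>t x i. i < d \<Longrightarrow> 0 \<le> b t x i"
    and b_integrable: "\<And>t i. i < d \<Longrightarrow> integrable M (\<lambda>\<omega>. b t (eta t \<omega>) i)"
    and b_mean: "\<And>t i. i < d \<Longrightarrow> (\<integral>\<omega>. b t (eta t \<omega>) i \<partial>M) = b_mean t i"
begin

text \<open>The lag terms along a noise path \<open>e\<close>, their sum over the past (meaningful only where the series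
  converges), and the almost sure validity of the recursion for a process.\<close>

abbreviation path_lag :: "nat \<Rightarrow> int \<Rightarrow> (int \<Rightarrow> real) \<Rightarrow> nat \<Rightarrow> real" where
  "path_lag k t e i \<equiv> lag_term d (\<lambda>t. a t (e t)) (\<lambda>t. b t (e t)) k t i"

definition path_sum :: "int \<Rightarrow> (int \<Rightarrow> real) \<Rightarrow> nat \<Rightarrow> real" where
  "path_sum t e i = (\<Sum>k. path_lag k t e i)"

definition solves :: "(int \<Rightarrow> 'a \<Rightarrow> nat \<Rightarrow> real) \<Rightarrow> bool" where
  "solves y \<longleftrightarrow> (\<forall>t. AE \<omega> in M. \<forall>i<d. y t \<omega> i
     = b t (eta t \<omega>) i + (\<Sum>j<d. a t (eta t \<omega>) i j * y (t - 1) \<omega> j))"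

lemma eta_measurable: "eta t \<in> borel_measurable M"
  using indep unfolding indep_vars_def by blast

lemma path_lag_nonneg: "i < d \<Longrightarrow> 0 \<le> path_lag k t e i"
  by (intro lag_term_nonneg a_nonneg b_nonneg)

lemma path_lag_measurable:
  assumes "{..t} \<subseteq> J" "i < d"
  shows "(\<lambda>e. path_lag k t e i) \<in> borel_measurable (Pi\<^sub>M J (\<lambda>_. borel))"
  using assms
proof (induction k arbitrary: t i)
  case 0
  have "(\<lambda>e. b t (e t) i) \<in> borel_measurable (Pi\<^sub>M J (\<lambda>_. borel))"
    by (rule measurable_compose[where f = "\<lambda>e. e t" and g = "\<lambda>x. b t x i" and N = borel])
      (use 0 in \<open>auto intro!: b_measurable measurable_component_singleton\<close>)
  then show ?case by (simp only: lag_term.simps)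
next
  case (Suc k)
  then have "t \<in> J" and sub: "{..t - 1} \<subseteq> J" by auto
  have "(\<lambda>e. a t (e t) i j) \<in> borel_measurable (Pi\<^sub>M J (\<lambda>_. borel))" if "j < d" for j
    by (rule measurable_compose[where f = "\<lambda>e. e t" and g = "\<lambda>x. a t x i j" and N = borel])
      (use \<open>t \<in> J\<close> Suc.prems that in \<open>auto intro!: a_measurable measurable_component_singleton\<close>)
  then show ?case
    unfolding lag_term.simps
    by (intro borel_measurable_sum borel_measurable_times Suc.IH[OF sub]) auto
qed

lemma path_sum_measurable:
  assumes "i < d"
  shows "(\<lambda>e. path_sum t e i) \<in> borel_measurable (Pi\<^sub>M UNIV (\<lambda>_. borel))"
  unfolding path_sum_def by (intro borel_measurable_suminf path_lag_measurable assms) auto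

text \<open>The factors of a lag term involve the noise at different times, so the expectation of the
  product is the product of the expectations.\<close>

lemma path_lag_expectation:
  assumes "i < d"
  shows "integrable M (\<lambda>\<omega>. path_lag k t (\<lambda>r. eta r \<omega>) i)"
    and "(\<integral>\<omega>. path_lag k t (\<lambda>r. eta r \<omega>) i \<partial>M) = lag_term d a_mean b_mean k t i"
proof -
  have "integrable M (\<lambda>\<omega>. path_lag k t (\<lambda>r. eta r \<omega>) i) \<and>
    (\<integral>\<omega>. path_lag k t (\<lambda>r. eta r \<omega>) i \<partial>M) = lag_term d a_mean b_mean k t i"
    using assms
  proof (induction k arbitrary: t i)
    case 0
    then show ?case by (simp add: b_integrable b_mean)
  next
    case (Suc k)
    let ?X = "\<lambda>j \<omega>. a t (eta t \<omega>) i j" and ?Z = "\<lambda>j \<omega>. path_lag k (t - 1) (\<lambda>r. eta r \<omega>) j"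
    have ind: "indep_var borel (?X j) borel (?Z j)" if j: "j < d" for j
    proof -
      have "indep_var (Pi\<^sub>M {t} (\<lambda>_. borel)) (\<lambda>\<omega>. restrict (\<lambda>r. eta r \<omega>) {t})
          (Pi\<^sub>M {..t - 1} (\<lambda>_. borel)) (\<lambda>\<omega>. restrict (\<lambda>r. eta r \<omega>) {..t - 1})"
        by (rule indep_var_restrict[OF indep]) auto
      moreover have "(\<lambda>e. a t (e t) i j) \<in> borel_measurable (Pi\<^sub>M {t} (\<lambda>_. borel))"
        by (rule measurable_compose[where f = "\<lambda>e. e t" and g = "\<lambda>x. a t x i j" and N = borel])
          (use \<open>i < d\<close> j in \<open>auto intro!: a_measurable measurable_component_singleton\<close>)
      moreover have "(\<lambda>e. path_lag k (t - 1) e j) \<in> borel_measurable (Pi\<^sub>M {..t - 1} (\<lambda>_. borel))"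
        by (rule path_lag_measurable[OF order_refl j])
      ultimately have "indep_var borel ((\<lambda>e. a t (e t) i j) \<circ> (\<lambda>\<omega>. restrict (\<lambda>r. eta r \<omega>) {t}))
          borel ((\<lambda>e. path_lag k (t - 1) e j) \<circ> (\<lambda>\<omega>. restrict (\<lambda>r. eta r \<omega>) {..t - 1}))"
        by (rule indep_var_compose)
      moreover have "(\<lambda>e. path_lag k (t - 1) e j) \<circ> (\<lambda>\<omega>. restrict (\<lambda>r. eta r \<omega>) {..t - 1}) = ?Z j"
        using j by (auto simp: fun_eq_iff intro!: lag_term_cong)
      ultimately show ?thesis by (simp add: comp_def)
    qed
    have prod: "integrable M (\<lambda>\<omega>. ?X j \<omega> * ?Z j \<omega>)"
      "(\<integral>\<omega>. ?X j \<omega> * ?Z j \<omega> \<partial>M) = a_mean t i j * lag_term d a_mean b_mean k (t - 1) j"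
      if j: "j < d" for j
      using Suc.IH[OF j, of "t - 1"] a_integrable[OF \<open>i < d\<close> j, of t] a_mean[OF \<open>i < d\<close> j, of t]
      by (auto simp: indep_var_lebesgue_integral[OF ind[OF j]] intro!: indep_var_integrable[OF ind[OF j]])
    then show ?case
      by (auto simp: Bochner_Integration.integral_sum intro!: Bochner_Integration.integrable_sum)
  qed
  then show "integrable M (\<lambda>\<omega>. path_lag k t (\<lambda>r. eta r \<omega>) i)"
    and "(\<integral>\<omega>. path_lag k t (\<lambda>r. eta r \<omega>) i \<partial>M) = lag_term d a_mean b_mean k t i"
    by auto
qed

lemma AE_path_lag_summable:
  assumes sm: "summable (\<lambda>k. lag_term d a_mean b_mean k t i)" and i: "i < d"
  shows "AE \<omega> in M. summable (\<lambda>k. path_lag k t (\<lambda>r. eta r \<omega>) i)"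
proof -
  define Z where "Z k \<omega> = path_lag k t (\<lambda>r. eta r \<omega>) i" for k \<omega>
  have Z: "integrable M (Z k)" "(\<integral>\<omega>. Z k \<omega> \<partial>M) = lag_term d a_mean b_mean k t i" for k
    unfolding Z_def by (rule path_lag_expectation[OF i])+
  then have [measurable]: "Z k \<in> borel_measurable M" for k by auto
  have Z_nonneg: "0 \<le> Z k \<omega>" for k \<omega>
    unfolding Z_def by (rule path_lag_nonneg[OF i])
  have nn: "0 \<le> lag_term d a_mean b_mean k t i" for k
    unfolding Z(2)[symmetric] by (intro Bochner_Integration.integral_nonneg Z_nonneg)
  have "(\<integral>\<^sup>+\<omega>. (\<Sum>k. ennreal (Z k \<omega>)) \<partial>M) = (\<Sum>k. \<integral>\<^sup>+\<omega>. ennreal (Z k \<omega>) \<partial>M)"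
    by (rule nn_integral_suminf) measurable
  also have "\<dots> = (\<Sum>k. ennreal (lag_term d a_mean b_mean k t i))"
    by (simp add: nn_integral_eq_integral Z Z_nonneg)
  also have "\<dots> = ennreal (\<Sum>k. lag_term d a_mean b_mean k t i)"
    by (rule suminf_ennreal2[OF nn sm])
  finally have "(\<integral>\<^sup>+\<omega>. (\<Sum>k. ennreal (Z k \<omega>)) \<partial>M) \<noteq> \<infinity>" by simp
  then have "AE \<omega> in M. (\<Sum>k. ennreal (Z k \<omega>)) \<noteq> \<infinity>"
    by (rule nn_integral_PInf_AE[rotated]) measurable
  then have "AE \<omega> in M. summable (\<lambda>k. Z k \<omega>)"
    by eventually_elim (auto intro!: summable_suminf_not_top Z_nonneg)
  then show ?thesis unfolding Z_def .
qed

lemma path_sum_solution: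
  assumes sm: "\<And>t i. i < d \<Longrightarrow> summable (\<lambda>k. lag_term d a_mean b_mean k t i)"
  shows "solves (\<lambda>t \<omega>. path_sum t (\<lambda>r. eta r \<omega>))"
    and "i < d \<Longrightarrow> integrable M (\<lambda>\<omega>. path_sum t (\<lambda>r. eta r \<omega>) i)"
    and "AE \<omega> in M. \<forall>i<d. 0 \<le> path_sum t (\<lambda>r. eta r \<omega>) i"
proof -
  have ae: "AE \<omega> in M. \<forall>i<d. summable (\<lambda>k. path_lag k t (\<lambda>r. eta r \<omega>) i)" for t
    using AE_path_lag_summable[OF sm] by (simp add: AE_all_countable)
  show "solves (\<lambda>t \<omega>. path_sum t (\<lambda>r. eta r \<omega>))"
    unfolding solves_def
  proof
    fix t
    show "AE \<omega> in M. \<forall>i<d. path_sum t (\<lambda>r. eta r \<omega>) i = b t (eta t \<omega>) i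
        + (\<Sum>j<d. a t (eta t \<omega>) i j * path_sum (t - 1) (\<lambda>r. eta r \<omega>) j)"
      using ae[of "t - 1"]
      by eventually_elim (simp add: path_sum_def suminf_lag_term(1))
  qed
  show "AE \<omega> in M. \<forall>i<d. 0 \<le> path_sum t (\<lambda>r. eta r \<omega>) i"
    using ae[of t]
    by eventually_elim (auto simp: path_sum_def intro!: suminf_nonneg path_lag_nonneg)
  show "integrable M (\<lambda>\<omega>. path_sum t (\<lambda>r. eta r \<omega>) i)" if i: "i < d"
    unfolding path_sum_def
  proof (rule integrable_suminf)
    show "\<And>k. integrable M (\<lambda>\<omega>. path_lag k t (\<lambda>r. eta r \<omega>) i)"
      by (rule path_lag_expectation(1)[OF i])
    show "AE \<omega> in M. summable (\<lambda>k. norm (path_lag k t (\<lambda>r. eta r \<omega>) i))"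
      using AE_path_lag_summable[OF sm[OF i] i] by (simp add: path_lag_nonneg i)
    show "summable (\<lambda>k. \<integral>\<omega>. norm (path_lag k t (\<lambda>r. eta r \<omega>) i) \<partial>M)"
      using sm[OF i] by (simp add: path_lag_nonneg path_lag_expectation i)
  qed
qed

text \<open>A nonnegative solution dominates the partial sums of the lag terms, whatever its dependence on
  the noise. If it is integrable, the expected lag terms are therefore summable.\<close>

lemma summable_of_integrable_solution:
  assumes sol: "solves y" and nonneg: "\<And>t. AE \<omega> in M. \<forall>i<d. 0 \<le> y t \<omega> i"
    and int: "integrable M (\<lambda>\<omega>. y t \<omega> i)" and i: "i < d"
  shows "summable (\<lambda>k. lag_term d a_mean b_mean k t i)"
proof (rule summableI_nonneg_bounded)
  fix N :: nat
  show "0 \<le> lag_term d a_mean b_mean N t i"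
    unfolding path_lag_expectation(2)[OF i, symmetric]
    by (intro Bochner_Integration.integral_nonneg path_lag_nonneg i)
  have "AE \<omega> in M. \<forall>t. \<forall>i<d. y t \<omega> i
      = b t (eta t \<omega>) i + (\<Sum>j<d. a t (eta t \<omega>) i j * y (t - 1) \<omega> j)"
    using sol by (simp add: solves_def AE_all_countable)
  moreover have "AE \<omega> in M. \<forall>t. \<forall>i<d. 0 \<le> y t \<omega> i"
    using nonneg by (simp add: AE_all_countable)
  ultimately have "AE \<omega> in M. (\<Sum>k<N. path_lag k t (\<lambda>r. eta r \<omega>) i) \<le> y t \<omega> i"
  proof eventually_elim
    case (elim \<omega>)
    show ?case
    proof (rule lag_term_partial_sum_le[where g = "\<lambda>t i. y t \<omega> i"])
      show "b t (eta t \<omega>) i + (\<Sum>j<d. a t (eta t \<omega>) i j * y (t - 1) \<omega> j) \<le> y t \<omega> i"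
        if "i < d" for t i
        by (rule eq_refl) (rule elim(1)[rule_format, OF that, symmetric])
    qed (use elim(2) a_nonneg i in auto)
  qed
  then have "(\<integral>\<omega>. (\<Sum>k<N. path_lag k t (\<lambda>r. eta r \<omega>) i) \<partial>M) \<le> (\<integral>\<omega>. y t \<omega> i \<partial>M)"
    using path_lag_expectation(1)[OF i] int by (intro integral_mono_AE) auto
  then show "(\<Sum>k<N. lag_term d a_mean b_mean k t i) \<le> (\<integral>\<omega>. y t \<omega> i \<partial>M)"
    using path_lag_expectation[OF i] by (simp add: Bochner_Integration.integral_sum)
qed

text \<open>The difference of two solutions satisfies \<open>\<bar>D t\<bar> \<le> R k * \<bar>D (t - k)\<bar>\<close> with the row sums \<open>R k\<close>
  of a product of \<open>k\<close> coefficient matrices. The two factors may be dependent, but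
  \<open>sqrt (R * D) \<le> (l * R + D / l) / 2\<close> separates them: the expectation of \<open>R k\<close> tends to 0, that of
  \<open>\<bar>D (t - k)\<bar>\<close> stays bounded, and \<open>l\<close> is arbitrary.\<close>

lemma solution_unique:
  assumes sol: "solves y" "solves y'"
    and int: "\<And>t i. i < d \<Longrightarrow> integrable M (\<lambda>\<omega>. y t \<omega> i)" "\<And>t i. i < d \<Longrightarrow> integrable M (\<lambda>\<omega>. y' t \<omega> i)"
    and C: "\<And>t. (\<Sum>i<d. \<integral>\<omega>. \<bar>y t \<omega> i\<bar> \<partial>M) \<le> C" "\<And>t. (\<Sum>i<d. \<integral>\<omega>. \<bar>y' t \<omega> i\<bar> \<partial>M) \<le> C"
    and decay: "\<And>i. i < d \<Longrightarrow> (\<lambda>k. lag_term d a_mean (\<lambda>_ _. 1) k t i) \<longlonglongrightarrow> 0"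
    and i: "i < d"
  shows "AE \<omega> in M. y t \<omega> i = y' t \<omega> i"
proof -
  interpret one: random_recursion M eta d a a_mean "\<lambda>_ _ _. 1" "\<lambda>_ _. 1"
    by unfold_locales
      (auto simp: indep a_measurable a_nonneg a_integrable a_mean prob_space)
  let ?R = "\<lambda>k \<omega>. one.path_lag k t (\<lambda>r. eta r \<omega>) i"
  define D where "D t \<omega> i = y t \<omega> i - y' t \<omega> i" for t \<omega> i
  define S where "S t \<omega> = (\<Sum>j<d. \<bar>D t \<omega> j\<bar>)" for t \<omega>
  have intD: "integrable M (\<lambda>\<omega>. D t \<omega> i)" if "i < d" for t i
    unfolding D_def using int that by auto
  then have intS: "integrable M (S t)" for t
    unfolding S_def by (intro Bochner_Integration.integrable_sum integrable_abs) auto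
  have ES: "(\<integral>\<omega>. S t \<omega> \<partial>M) \<le> 2 * C" for t
  proof -
    have y: "integrable M (\<lambda>\<omega>. \<Sum>j<d. \<bar>y t \<omega> j\<bar>)" "integrable M (\<lambda>\<omega>. \<Sum>j<d. \<bar>y' t \<omega> j\<bar>)"
      using int by (intro Bochner_Integration.integrable_sum integrable_abs; simp)+
    have "S t \<omega> \<le> (\<Sum>j<d. \<bar>y t \<omega> j\<bar>) + (\<Sum>j<d. \<bar>y' t \<omega> j\<bar>)" for \<omega>
      unfolding S_def D_def sum.distrib[symmetric] by (intro sum_mono abs_triangle_ineq4)
    then have "(\<integral>\<omega>. S t \<omega> \<partial>M) \<le> (\<integral>\<omega>. (\<Sum>j<d. \<bar>y t \<omega> j\<bar>) + (\<Sum>j<d. \<bar>y' t \<omega> j\<bar>) \<partial>M)"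
      by (intro integral_mono intS Bochner_Integration.integrable_add y)
    also have "\<dots> = (\<Sum>j<d. \<integral>\<omega>. \<bar>y t \<omega> j\<bar> \<partial>M) + (\<Sum>j<d. \<integral>\<omega>. \<bar>y' t \<omega> j\<bar> \<partial>M)"
      unfolding Bochner_Integration.integral_add[OF y]
      using int by (simp add: Bochner_Integration.integral_sum)
    also have "\<dots> \<le> 2 * C" using C[of t] by simp
    finally show ?thesis .
  qed
  have "AE \<omega> in M. \<forall>t. \<forall>i<d. y t \<omega> i
      = b t (eta t \<omega>) i + (\<Sum>j<d. a t (eta t \<omega>) i j * y (t - 1) \<omega> j)"
    using sol(1) by (simp add: solves_def AE_all_countable)
  moreover have "AE \<omega> in M. \<forall>t. \<forall>i<d. y' t \<omega> i
      = b t (eta t \<omega>) i + (\<Sum>j<d. a t (eta t \<omega>) i j * y' (t - 1) \<omega> j)"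
    using sol(2) by (simp add: solves_def AE_all_countable)
  ultimately have bound: "AE \<omega> in M. \<forall>k. \<bar>D t \<omega> i\<bar> \<le> ?R k \<omega> * S (t - int k) \<omega>"
  proof eventually_elim
    case (elim \<omega>)
    show ?case
    proof
      fix k
      show "\<bar>D t \<omega> i\<bar> \<le> ?R k \<omega> * S (t - int k) \<omega>"
      proof (rule homogeneous_le_lag_term[where D = "\<lambda>t. D t \<omega>"])
        show "D t \<omega> i = (\<Sum>j<d. a t (eta t \<omega>) i j * D (t - 1) \<omega> j)" if "i < d" for t i
          unfolding D_def elim(1)[rule_format, OF that, of t] elim(2)[rule_format, OF that, of t]
          by (simp add: right_diff_distrib sum_subtractf)
        show "\<bar>D (t - int k) \<omega> j\<bar> \<le> S (t - int k) \<omega>" if "j < d" for j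
          unfolding S_def using that by (intro member_le_sum) auto
      qed (use a_nonneg i in auto)
    qed
  qed
  have amgm: "AE \<omega> in M. sqrt \<bar>D t \<omega> i\<bar> \<le> (l * ?R k \<omega> + S (t - int k) \<omega> / l) / 2"
    if "0 < l" for l k
    using bound
  proof eventually_elim
    case (elim \<omega>)
    have R: "0 \<le> ?R k \<omega>" by (rule one.path_lag_nonneg[OF i])
    have S: "0 \<le> S (t - int k) \<omega>" by (simp add: S_def sum_nonneg)
    have "sqrt \<bar>D t \<omega> i\<bar> \<le> sqrt ((l * ?R k \<omega>) * (S (t - int k) \<omega> / l))"
      using elim that by simp
    also have "\<dots> \<le> (l * ?R k \<omega> + S (t - int k) \<omega> / l) / 2"
      using that R S by (intro arith_geo_mean_sqrt) auto
    finally show ?case .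
  qed
  have int_rhs: "integrable M (\<lambda>\<omega>. (l * ?R k \<omega> + S (t - int k) \<omega> / l) / 2)" for l k
    using one.path_lag_expectation(1)[OF i] intS by auto
  have int_sqrt: "integrable M (\<lambda>\<omega>. sqrt \<bar>D t \<omega> i\<bar>)"
  proof (rule Bochner_Integration.integrable_bound[OF int_rhs[of 1 0]])
    have [measurable]: "(\<lambda>\<omega>. D t \<omega> i) \<in> borel_measurable M" using intD[OF i] by auto
    show "(\<lambda>\<omega>. sqrt \<bar>D t \<omega> i\<bar>) \<in> borel_measurable M" by measurable
    show "AE \<omega> in M. norm (sqrt \<bar>D t \<omega> i\<bar>) \<le> norm ((1 * ?R 0 \<omega> + S (t - int 0) \<omega> / 1) / 2)"
    proof -
      have "0 < (1 :: real)" by simp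
      from amgm[OF this, of 0] show ?thesis
        by eventually_elim (simp add: S_def sum_nonneg)
    qed
  qed
  let ?E = "\<integral>\<omega>. sqrt \<bar>D t \<omega> i\<bar> \<partial>M"
  have step: "?E \<le> (l * lag_term d a_mean (\<lambda>_ _. 1) k t i + 2 * C / l) / 2" if l: "0 < l" for l k
  proof -
    have "?E \<le> (\<integral>\<omega>. (l * ?R k \<omega> + S (t - int k) \<omega> / l) / 2 \<partial>M)"
      by (intro integral_mono_AE int_sqrt int_rhs amgm l)
    also have "\<dots> = (l * lag_term d a_mean (\<lambda>_ _. 1) k t i + (\<integral>\<omega>. S (t - int k) \<omega> \<partial>M) / l) / 2"
      using one.path_lag_expectation[OF i] intS by simp
    also have "\<dots> \<le> (l * lag_term d a_mean (\<lambda>_ _. 1) k t i + 2 * C / l) / 2"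
      using ES[of "t - int k"] l by (simp add: divide_right_mono)
    finally show ?thesis .
  qed
  have le: "?E \<le> C / l" if l: "0 < l" for l
  proof (rule LIMSEQ_le_const)
    have "(\<lambda>k. (l * lag_term d a_mean (\<lambda>_ _. 1) k t i + 2 * C / l) / 2) \<longlonglongrightarrow> (l * 0 + 2 * C / l) / 2"
      by (intro tendsto_intros decay[OF i]) auto
    then show "(\<lambda>k. (l * lag_term d a_mean (\<lambda>_ _. 1) k t i + 2 * C / l) / 2) \<longlonglongrightarrow> C / l" by simp
    show "\<exists>k0. \<forall>k\<ge>k0. ?E \<le> (l * lag_term d a_mean (\<lambda>_ _. 1) k t i + 2 * C / l) / 2"
      using step[OF l] by blast
  qed
  have "?E \<le> 0"
  proof (rule LIMSEQ_le_const)
    show "(\<lambda>n. C / real (Suc n)) \<longlonglongrightarrow> 0"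
      unfolding divide_inverse by (intro tendsto_mult_right_zero LIMSEQ_inverse_real_of_nat)
    show "\<exists>n0. \<forall>n\<ge>n0. ?E \<le> C / real (Suc n)" using le by simp
  qed
  moreover have "0 \<le> ?E" by simp
  ultimately have "?E = 0" by linarith
  then have "AE \<omega> in M. sqrt \<bar>D t \<omega> i\<bar> = 0"
    using int_sqrt by (subst (asm) integral_nonneg_eq_0_iff_AE) auto
  then show ?thesis by eventually_elim (simp add: D_def)
qed

end

section \<open>Stationary processes\<close>

text \<open>Uniqueness needs moments that are bounded uniformly in time; stationarity provides them.\<close>

lemma strictly_stationary_integral:
  assumes stat: "strictly_stationary M N Y" and Y: "\<And>t. Y t \<in> M \<rightarrow>\<^sub>M N"
    and g: "g \<in> borel_measurable N"
  shows "(\<integral>\<omega>. (g (Y t \<omega>) :: real) \<partial>M) = (\<integral>\<omega>. g (Y 0 \<omega>) \<partial>M)"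
proof -
  let ?P = "Pi\<^sub>M (UNIV :: int set) (\<lambda>_. N)"
  have g0: "(\<lambda>e. g (e 0)) \<in> borel_measurable ?P"
    by (rule measurable_compose[OF _ g]) (rule measurable_component_singleton, simp)
  have "(\<integral>\<omega>. g (Y (0 + h) \<omega>) \<partial>M) = (\<integral>e. g (e 0) \<partial>distr M ?P (\<lambda>\<omega> r. Y (r + h) \<omega>))" for h
    using g0 Y by (subst integral_distr) (auto intro: measurable_PiM_UNIV)
  note this[of t] this[of 0]
  moreover have "distr M ?P (\<lambda>\<omega> r. Y (r + t) \<omega>) = distr M ?P (\<lambda>\<omega> r. Y (r + 0) \<omega>)"
    using stat by (simp add: strictly_stationary_def)
  ultimately show ?thesis by simp
qed

lemma ergodic_process_AE_eq:
  assumes M: "prob_space M" and X: "ergodic_process M N X" and stat: "strictly_stationary M N Y"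
    and measurable: "\<And>t. X t \<in> M \<rightarrow>\<^sub>M N" "\<And>t. Y t \<in> M \<rightarrow>\<^sub>M N"
    and eq: "\<And>t. AE \<omega> in M. Y t \<omega> = X t \<omega>"
  shows "ergodic_process M N Y"
  unfolding ergodic_process_def
proof (intro conjI ballI impI stat)
  fix S assume S: "S \<in> sets (Pi\<^sub>M (UNIV :: int set) (\<lambda>_. N))"
    and inv: "(\<lambda>y t. y (t + 1)) -` S \<inter> space (Pi\<^sub>M UNIV (\<lambda>_. N)) = S"
  interpret prob_space M by (rule M)
  have path: "{\<omega> \<in> space M. (\<lambda>t. Z t \<omega>) \<in> S} \<in> sets M" if "\<And>t. Z t \<in> M \<rightarrow>\<^sub>M N" for Z :: "int \<Rightarrow> _"
    using measurable_sets[OF measurable_PiM_UNIV[of Z M "\<lambda>_. N"] S] that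
    by (simp add: vimage_def Int_def conj_commute)
  have "AE \<omega> in M. (\<lambda>t. Y t \<omega>) = (\<lambda>t. X t \<omega>)"
    using eq by (simp add: fun_eq_iff AE_all_countable)
  then have "measure M {\<omega> \<in> space M. (\<lambda>t. Y t \<omega>) \<in> S} = measure M {\<omega> \<in> space M. (\<lambda>t. X t \<omega>) \<in> S}"
    by (intro finite_measure_eq_AE path measurable) (auto elim!: eventually_mono)
  then show "measure M {\<omega> \<in> space M. (\<lambda>t. Y t \<omega>) \<in> S} \<in> {0, 1}"
    using X S inv unfolding ergodic_process_def by simp
qed

section \<open>The causal solution of the periodic GARCH equation\<close>

lemma season_decomposition:
  assumes "1 \<le> s"
  obtains r v where "t = int s * r + int (Suc v)" "v < s"
proof
  let ?r = "(t - 1) div int s" and ?v = "nat ((t - 1) mod int s)"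
  have "int s * ?r + (t - 1) mod int s = t - 1" by simp
  moreover have "0 \<le> (t - 1) mod int s" "(t - 1) mod int s < int s" using assms by auto
  ultimately show "t = int s * ?r + int (Suc ?v)" "?v < s" by (auto simp: nat_less_iff)
qed

lemma all_times_iff:
  assumes "1 \<le> s"
  shows "(\<forall>t. P t) \<longleftrightarrow> (\<forall>r. \<forall>v<s. P (int s * r + int (Suc v)))"
proof (intro iffI allI)
  fix t assume *: "\<forall>r. \<forall>v<s. P (int s * r + int (Suc v))"
  obtain r v where "t = int s * r + int (Suc v)" "v < s" using season_decomposition[OF assms] .
  with * show "P t" by blast
qed blast

lemma AE_all_less_iff:
  "(AE x in M. \<forall>v<n :: nat. P v x) \<longleftrightarrow> (\<forall>v<n. AE x in M. P v x)"
  using AE_ball_countable[of "{..<n}" "\<lambda>x v. P v x" M] by (simp add: Ball_def)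

text \<open>The coefficients of the model and its independent identically distributed noise, normalised to
  second moment 1.\<close>

locale pgarch = prob_space M for M :: "'a measure" +
  fixes s p q :: nat and alpha beta :: "nat \<Rightarrow> nat \<Rightarrow> real" and eps :: "int \<Rightarrow> 'a \<Rightarrow> real"
  assumes s: "1 \<le> s" and p: "1 \<le> p" and q: "1 \<le> q"
    and alpha0_pos: "\<And>v. v \<in> {1..s} \<Longrightarrow> 0 < alpha 0 v"
    and alpha_nonneg: "\<And>i v. i \<in> {1..p} \<Longrightarrow> v \<in> {1..s} \<Longrightarrow> 0 \<le> alpha i v"
    and beta_nonneg: "\<And>j v. j \<in> {1..q} \<Longrightarrow> v \<in> {1..s} \<Longrightarrow> 0 \<le> beta j v"
    and eps_indep: "indep_vars (\<lambda>_. borel) eps UNIV"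
    and eps_ident: "\<And>t. distr M borel (eps t) = distr M borel (eps 0)"
    and eps_moment2: "\<And>t. (\<integral>\<omega>. (eps t \<omega>)\<^sup>2 \<partial>M) = 1"
begin

text \<open>The noise that drives the recursion.\<close>

definition eta :: "int \<Rightarrow> 'a \<Rightarrow> real" where
  "eta t \<omega> = (eps t \<omega>)\<^sup>2"

text \<open>The absolute value does not change anything at the values of \<open>eta\<close> and makes the coefficients
  nonnegative on every path, not only on those of squares.\<close>

definition coeff :: "int \<Rightarrow> real \<Rightarrow> nat \<Rightarrow> nat \<Rightarrow> real" where
  "coeff t x = phi_entry p alpha beta (season s t) \<bar>x\<bar>"

definition inhom :: "int \<Rightarrow> real \<Rightarrow> nat \<Rightarrow> real" where
  "inhom t x = b_entry p alpha (season s t) \<bar>x\<bar>"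

text \<open>The expected coefficients, obtained by replacing the noise by its expectation 1.\<close>

definition mean_phi :: "nat \<Rightarrow> real mat" where
  "mean_phi v = pgarch_phi p q alpha beta v (Matrix.vec s (\<lambda>_. 1))"

definition mean_b :: "nat \<Rightarrow> real Matrix.vec" where
  "mean_b v = pgarch_b p q alpha v (Matrix.vec s (\<lambda>_. 1))"

lemma phi_entry_nonneg:
  assumes "v \<in> {1..s}" "0 \<le> x" "j < p + q"
  shows "0 \<le> phi_entry p alpha beta v x i j"
  using assms alpha_nonneg[of "j + 1" v] beta_nonneg[of "j - p + 1" v]
  by (auto simp: phi_entry_def Let_def)

lemma b_entry_nonneg: "v \<in> {1..s} \<Longrightarrow> 0 \<le> x \<Longrightarrow> 0 \<le> b_entry p alpha v x i"
  using alpha0_pos[of v] by (auto simp: b_entry_def intro!: mult_nonneg_nonneg)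

lemma phi_entry_affine: "\<exists>c0 c1. \<forall>x. phi_entry p alpha beta v x i j = c0 + c1 * x"
proof (cases "i = 0")
  case True
  then show ?thesis
    by (intro exI[of _ 0] exI[of _ "phi_entry p alpha beta v 1 i j"]) (simp add: phi_entry_def Let_def)
next
  case False
  then show ?thesis
    by (intro exI[of _ "phi_entry p alpha beta v 0 i j"] exI[of _ 0]) (simp add: phi_entry_def)
qed

lemma b_entry_affine: "\<exists>c0 c1. \<forall>x. b_entry p alpha v x i = c0 + c1 * x"
  by (rule exI[of _ "if i = 0 then 0 else b_entry p alpha v 0 i"],
      rule exI[of _ "if i = 0 then alpha 0 v else 0"]) (simp add: b_entry_def)

lemma mean_phi_entry:
  assumes "v \<in> {1..s}" "i < p + q" "j < p + q"
  shows "mean_phi v $$ (i, j) = phi_entry p alpha beta v 1 i j"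
  using assms p by (subst mean_phi_def, subst pgarch_phi_eq_entry) auto

lemma mean_b_entry:
  assumes "v \<in> {1..s}" "i < p + q"
  shows "mean_b v $ i = b_entry p alpha v 1 i"
  using assms by (subst mean_b_def, subst pgarch_b_eq_entry) auto

sublocale periodic: periodic_recursion s "p + q" mean_phi mean_b
proof
  show "mean_phi v \<in> carrier_mat (p + q) (p + q)" "mean_b v \<in> carrier_vec (p + q)" for v
    by (simp_all add: mean_phi_def mean_b_def pgarch_phi_carrier pgarch_b_carrier)
qed (use s p in \<open>simp_all add: mean_phi_entry mean_b_entry phi_entry_nonneg b_entry_nonneg\<close>)

lemma eps_measurable: "eps t \<in> borel_measurable M"
  using eps_indep unfolding indep_vars_def by blast

lemma eta_indep: "indep_vars (\<lambda>_. borel) eta UNIV"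
  unfolding eta_def[abs_def] by (rule indep_vars_compose2[OF eps_indep]) simp

lemma eta_measurable: "eta t \<in> borel_measurable M"
  using eta_indep unfolding indep_vars_def by blast

lemma eta_integrable: "integrable M (eta t)"
  using eps_moment2[of t] not_integrable_integral_eq[of M "eta t"] by (force simp: eta_def[abs_def])

lemma eta_mean: "(\<integral>\<omega>. eta t \<omega> \<partial>M) = 1"
  using eps_moment2 by (simp add: eta_def)

lemma coeff_eta: "coeff t (eta t \<omega>) = phi_entry p alpha beta (season s t) (eta t \<omega>)"
  by (simp add: coeff_def eta_def)

lemma inhom_eta: "inhom t (eta t \<omega>) = b_entry p alpha (season s t) (eta t \<omega>)"
  by (simp add: inhom_def eta_def)

sublocale rec: random_recursion M eta "p + q" coeff periodic.m inhom periodic.b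
proof
  fix t i j assume i: "i < p + q" and j: "j < p + q"
  show "(\<lambda>x. coeff t x i j) \<in> borel_measurable borel"
    unfolding coeff_def phi_entry_def Let_def by simp
  show "0 \<le> coeff t x i j" for x
    unfolding coeff_def by (rule phi_entry_nonneg[OF season_in[OF s] _ j]) simp
  obtain c0 c1 where *: "\<And>x. phi_entry p alpha beta (season s t) x i j = c0 + c1 * x"
    using phi_entry_affine by blast
  show "integrable M (\<lambda>\<omega>. coeff t (eta t \<omega>) i j)"
    unfolding coeff_eta * using eta_integrable by simp
  show "(\<integral>\<omega>. coeff t (eta t \<omega>) i j \<partial>M) = periodic.m t i j"
    unfolding coeff_eta mean_phi_entry[OF season_in[OF s] i j] *
    using eta_integrable by (simp add: eta_mean prob_space)
next
  fix t i assume i: "i < p + q"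
  show "(\<lambda>x. inhom t x i) \<in> borel_measurable borel"
    unfolding inhom_def b_entry_def by simp
  show "0 \<le> inhom t x i" for x
    unfolding inhom_def by (rule b_entry_nonneg[OF season_in[OF s]]) simp
  obtain c0 c1 where *: "\<And>x. b_entry p alpha (season s t) x i = c0 + c1 * x"
    using b_entry_affine by blast
  show "integrable M (\<lambda>\<omega>. inhom t (eta t \<omega>) i)"
    unfolding inhom_eta * using eta_integrable by simp
  show "(\<integral>\<omega>. inhom t (eta t \<omega>) i \<partial>M) = periodic.b t i"
    unfolding inhom_eta mean_b_entry[OF season_in[OF s] i] *
    using eta_integrable by (simp add: eta_mean prob_space)
qed (rule eta_indep)

lemma monodromy_eq:
  "mat_prod (p + q) (\<lambda>v. pgarch_mean_phi M s p q alpha beta eps (s - v)) s = periodic.monodromy"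
proof (rule mat_prod_cong)
  fix v assume "v < s"
  then have "s - v \<in> {1..s}" by auto
  then show "pgarch_mean_phi M s p q alpha beta eps (s - v) = mean_phi (s - v)"
    unfolding mean_phi_def by (rule pgarch_mean_phi_eq[OF prob_space_axioms eps_moment2])
qed

text \<open>The states at the single times, read off from the vectors for whole periods.\<close>

definition state :: "(int \<Rightarrow> 'a \<Rightarrow> real Matrix.vec) \<Rightarrow> int \<Rightarrow> 'a \<Rightarrow> nat \<Rightarrow> real" where
  "state Y t \<omega> i = Y ((t - 1) div int s) \<omega> $ ((p + q) * (season s t - 1) + i)"

lemma state_eq: "v < s \<Longrightarrow> state Y (int s * r + int (Suc v)) \<omega> i = Y r \<omega> $ ((p + q) * v + i)"
  by (simp only: state_def season_eq) simp

lemma equation_iff_state: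
  assumes "\<And>t. Y t \<omega> \<in> carrier_vec ((p + q) * s)"
  shows "Y r \<omega> = pgarch_A s p q alpha beta (eta_vec s eps r \<omega>) *\<^sub>v Y (r - 1) \<omega>
            + pgarch_B s p q alpha beta (eta_vec s eps r \<omega>) \<longleftrightarrow>
    (\<forall>v<s. \<forall>i<p + q. let t = int s * r + int (Suc v) in
       state Y t \<omega> i = inhom t (eta t \<omega>) i
         + (\<Sum>j<p + q. coeff t (eta t \<omega>) i j * state Y (t - 1) \<omega> j))"
proof -
  have step: "pgarch_b p q alpha (Suc v) (eta_vec s eps r \<omega>) $ i
       + (\<Sum>j<p + q. pgarch_phi p q alpha beta (Suc v) (eta_vec s eps r \<omega>) $$ (i, j)
            * (if v = 0 then Y (r - 1) \<omega> $ ((p + q) * (s - 1) + j)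
               else Y r \<omega> $ ((p + q) * (v - 1) + j)))
     = inhom t (eta t \<omega>) i + (\<Sum>j<p + q. coeff t (eta t \<omega>) i j * state Y (t - 1) \<omega> j)"
    if v: "v < s" and i: "i < p + q" and t: "t = int s * r + int (Suc v)" for v i t
  proof -
    have u: "eta_vec s eps r \<omega> $ v = eta t \<omega>"
      using v by (simp add: eta_vec_def eta_def t algebra_simps)
    have season: "season s t = Suc v" unfolding t by (rule season_eq[OF v])
    have "state Y (t - 1) \<omega> j = (if v = 0 then Y (r - 1) \<omega> $ ((p + q) * (s - 1) + j)
               else Y r \<omega> $ ((p + q) * (v - 1) + j))" for j
    proof (cases v)
      case 0
      then have "t - 1 = int s * (r - 1) + int (Suc (s - 1))"
        using s by (simp add: t algebra_simps)
      then show ?thesis using 0 s by (simp only: state_eq) simp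
    next
      case (Suc w)
      then have "t - 1 = int s * r + int (Suc w)" by (simp add: t)
      then show ?thesis using Suc v by (simp only: state_eq) simp
    qed
    then show ?thesis
      using i p by (simp add: pgarch_b_eq_entry pgarch_phi_eq_entry coeff_eta inhom_eta u season)
  qed
  have d: "0 < p + q" using p by simp
  show ?thesis
    unfolding pgarch_equation_iff[OF s d assms assms]
    by (intro all_cong1 imp_cong refl) (simp only: Let_def state_eq step)
qed

lemma solves_state_iff:
  assumes Y: "\<And>t. Y t \<in> M \<rightarrow>\<^sub>M vec_borel ((p + q) * s)"
  shows "rec.solves (state Y) \<longleftrightarrow>
    (\<forall>r. AE \<omega> in M. Y r \<omega> = pgarch_A s p q alpha beta (eta_vec s eps r \<omega>) *\<^sub>v Y (r - 1) \<omega>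
            + pgarch_B s p q alpha beta (eta_vec s eps r \<omega>))"
proof -
  let ?R = "\<lambda>t \<omega>. \<forall>i<p + q. state Y t \<omega> i = inhom t (eta t \<omega>) i
         + (\<Sum>j<p + q. coeff t (eta t \<omega>) i j * state Y (t - 1) \<omega> j)"
  have carrier: "Y t \<omega> \<in> carrier_vec ((p + q) * s)" if "\<omega> \<in> space M" for t \<omega>
    using measurable_space[OF Y that] by simp
  have "rec.solves (state Y) \<longleftrightarrow> (\<forall>t. AE \<omega> in M. ?R t \<omega>)"
    by (simp add: rec.solves_def)
  also have "\<dots> \<longleftrightarrow> (\<forall>r. \<forall>v<s. AE \<omega> in M. ?R (int s * r + int (Suc v)) \<omega>)"
    by (rule all_times_iff[OF s])
  also have "\<dots> \<longleftrightarrow> (\<forall>r. AE \<omega> in M. \<forall>v<s. ?R (int s * r + int (Suc v)) \<omega>)"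
    by (intro all_cong1 AE_all_less_iff[symmetric])
  also have "\<dots> \<longleftrightarrow> (\<forall>r. AE \<omega> in M. Y r \<omega> = pgarch_A s p q alpha beta (eta_vec s eps r \<omega>) *\<^sub>v Y (r - 1) \<omega>
            + pgarch_B s p q alpha beta (eta_vec s eps r \<omega>))"
    by (intro all_cong1 AE_cong, subst equation_iff_state) (auto simp: Let_def carrier)
  finally show ?thesis .
qed

context
  fixes Y assumes Y: "stationary_L1_solution M s p q alpha beta eps Y"
begin

lemma solution_measurable: "Y t \<in> M \<rightarrow>\<^sub>M vec_borel ((p + q) * s)"
  using Y by (simp add: stationary_L1_solution_def pgarch_vector_solution_def)

lemma state_solves: "rec.solves (state Y)"
  using Y solves_state_iff[of Y, OF solution_measurable]
  by (simp add: stationary_L1_solution_def pgarch_vector_solution_def)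

lemma state_nonneg: "AE \<omega> in M. \<forall>i<p + q. 0 \<le> state Y t \<omega> i"
proof -
  obtain r v where t: "t = int s * r + int (Suc v)" "v < s" using season_decomposition[OF s] .
  have "AE \<omega> in M. \<forall>i<(p + q) * s. 0 \<le> Y r \<omega> $ i"
    using Y by (simp add: stationary_L1_solution_def pgarch_vector_solution_def)
  then show ?thesis
    by eventually_elim (use t in \<open>simp add: state_eq block_index_less del: of_nat_Suc\<close>)
qed

lemma state_integrable: "i < p + q \<Longrightarrow> integrable M (\<lambda>\<omega>. state Y t \<omega> i)"
proof -
  assume i: "i < p + q"
  obtain r v where t: "t = int s * r + int (Suc v)" "v < s" using season_decomposition[OF s] .
  have "integrable M (\<lambda>\<omega>. Y r \<omega> $ ((p + q) * v + i))"
    using Y block_index_less[OF t(2) i] solution_measurable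
    by (intro integrable_component) (auto simp: stationary_L1_solution_def)
  then show ?thesis using t by (simp add: state_eq del: of_nat_Suc)
qed

lemma state_moments_bounded: "\<exists>C. \<forall>t. (\<Sum>i<p + q. \<integral>\<omega>. \<bar>state Y t \<omega> i\<bar> \<partial>M) \<le> C"
proof (intro exI allI)
  fix t
  let ?e = "\<lambda>v. \<Sum>i<p + q. \<integral>\<omega>. \<bar>Y 0 \<omega> $ ((p + q) * v + i)\<bar> \<partial>M"
  obtain r v where t: "t = int s * r + int (Suc v)" "v < s" using season_decomposition[OF s] .
  have "(\<integral>\<omega>. \<bar>state Y t \<omega> i\<bar> \<partial>M) = (\<integral>\<omega>. \<bar>Y 0 \<omega> $ ((p + q) * v + i)\<bar> \<partial>M)" if i: "i < p + q" for i
  proof -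
    have "(\<integral>\<omega>. \<bar>Y r \<omega> $ ((p + q) * v + i)\<bar> \<partial>M) = (\<integral>\<omega>. \<bar>Y 0 \<omega> $ ((p + q) * v + i)\<bar> \<partial>M)"
      using Y measurable_vec_borel_component[OF block_index_less[OF t(2) i]]
      by (intro strictly_stationary_integral[where N = "vec_borel ((p + q) * s)"
            and g = "\<lambda>y. \<bar>y $ ((p + q) * v + i)\<bar>"] solution_measurable borel_measurable_abs)
         (auto simp: stationary_L1_solution_def)
    then show ?thesis using t by (simp add: state_eq del: of_nat_Suc)
  qed
  then have "(\<Sum>i<p + q. \<integral>\<omega>. \<bar>state Y t \<omega> i\<bar> \<partial>M) = ?e v" by simp
  also have "\<dots> \<le> (\<Sum>v<s. ?e v)"
    using t(2) by (intro member_le_sum) (auto intro!: sum_nonneg)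
  finally show "(\<Sum>i<p + q. \<integral>\<omega>. \<bar>state Y t \<omega> i\<bar> \<partial>M) \<le> (\<Sum>v<s. ?e v)" .
qed

end

text \<open>Every component of the state receives a positive contribution: the constant \<open>\<alpha>\<^sub>0\<close> enters at
  the rows 0 and \<open>p\<close> and is moved down by the subdiagonals.\<close>

lemma mean_lag_pos:
  assumes r: "r \<in> {0, p}" and rows: "\<And>l. l \<in> {1..k} \<Longrightarrow> r + l \<noteq> p" and "r + k < p + q"
  shows "0 < lag_term (p + q) periodic.m periodic.b k t (r + k)"
  using rows \<open>r + k < p + q\<close>
proof (induction k arbitrary: t)
  case 0
  then show ?case
    using r p alpha0_pos[OF season_in[OF s, of t]] season_in[OF s, of t]
    by (auto simp: mean_b_entry b_entry_def simp del: atLeastAtMost_iff)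
next
  case (Suc k)
  let ?L = "lag_term (p + q) periodic.m periodic.b k (t - 1)"
  have nn: "0 \<le> ?L j" if "j < p + q" for j
    by (rule lag_term_nonneg[OF periodic.m_nonneg periodic.b_nonneg that])
  have "0 < ?L (r + k)" using Suc.prems by (intro Suc.IH) auto
  have row: "r + Suc k \<noteq> p" using Suc.prems(1)[of "Suc k"] by auto
  note \<open>0 < ?L (r + k)\<close>
  also have "?L (r + k) = periodic.m t (r + Suc k) (r + k) * ?L (r + k)"
    using Suc.prems(2) row season_in[OF s, of t]
    by (simp add: mean_phi_entry phi_entry_def del: atLeastAtMost_iff)
  also have "\<dots> \<le> (\<Sum>j<p + q. periodic.m t (r + Suc k) j * ?L j)"
    using Suc.prems(2) nn periodic.m_nonneg
    by (intro member_le_sum[where f = "\<lambda>j. periodic.m t (r + Suc k) j * ?L j"]) auto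
  finally show ?case by simp
qed

lemma spectral_radius_of_solution:
  assumes Y: "stationary_L1_solution M s p q alpha beta eps Y"
  shows "spectral_radius (map_mat complex_of_real periodic.monodromy) < 1"
proof (rule periodic.spectral_radius_of_summable)
  show sm: "summable (\<lambda>k. lag_term (p + q) periodic.m periodic.b k t i)" if "i < p + q" for t i
    by (rule rec.summable_of_integrable_solution[OF state_solves state_nonneg state_integrable])
       (use Y that in auto)
  fix i assume i: "i < p + q"
  have "\<exists>k. 0 < lag_term (p + q) periodic.m periodic.b k 0 i"
  proof (cases "i < p")
    case True
    then show ?thesis using mean_lag_pos[of 0 i 0] i by auto
  next
    case False
    then show ?thesis using mean_lag_pos[of p "i - p" 0] i by auto
  qed
  then obtain k where "0 < lag_term (p + q) periodic.m periodic.b k 0 i" ..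
  then show "0 < (\<Sum>k. lag_term (p + q) periodic.m periodic.b k 0 i)"
    using sm[OF i]
    by (intro suminf_pos2) (auto intro!: lag_term_nonneg periodic.m_nonneg periodic.b_nonneg i)
qed

text \<open>The stacked states at the times \<open>1, \<dots>, s\<close> that the noise path \<open>e\<close> produces. Applied to the shifts
  of the noise by whole periods, it gives the causal solution.\<close>

definition period_sum :: "(int \<Rightarrow> real) \<Rightarrow> real Matrix.vec" where
  "period_sum e = Matrix.vec ((p + q) * s)
     (\<lambda>k. rec.path_sum (int (Suc (k div (p + q)))) e (k mod (p + q)))"

definition causal_solution :: "int \<Rightarrow> 'a \<Rightarrow> real Matrix.vec" where
  "causal_solution t \<omega> = period_sum (\<lambda>r. eta (r + int s * t) \<omega>)"

lemma period_sum_measurable: "period_sum \<in> Pi\<^sub>M UNIV (\<lambda>_. borel) \<rightarrow>\<^sub>M vec_borel ((p + q) * s)"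
proof (rule measurable_vec_borelI)
  fix k assume "k < (p + q) * s"
  then show "(\<lambda>e. period_sum e $ k) \<in> borel_measurable (Pi\<^sub>M UNIV (\<lambda>_. borel))"
    using p by (simp add: period_sum_def rec.path_sum_measurable)
qed (simp add: period_sum_def)

lemma causal_solution_measurable: "causal_solution t \<in> M \<rightarrow>\<^sub>M vec_borel ((p + q) * s)"
  unfolding causal_solution_def[abs_def]
  by (rule measurable_compose[OF _ period_sum_measurable])
     (rule measurable_PiM_UNIV, rule eta_measurable)

lemma path_sum_shift:
  "rec.path_sum t (\<lambda>r. e (r + int s * h)) i = rec.path_sum (t + int s * h) e i"
proof -
  have "lag_term (p + q) (\<lambda>t. coeff t (e (t + int s * h))) (\<lambda>t. inhom t (e (t + int s * h))) k t i
      = lag_term (p + q) (\<lambda>t. coeff t (e t)) (\<lambda>t. inhom t (e t)) k (t + int s * h) i" for k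
    unfolding lag_term_shift[symmetric] by (simp add: coeff_def inhom_def season_add_period)
  then show ?thesis by (simp add: rec.path_sum_def)
qed

lemma state_causal_solution:
  assumes i: "i < p + q"
  shows "state causal_solution t \<omega> i = rec.path_sum t (\<lambda>r. eta r \<omega>) i"
proof -
  obtain r v where t: "t = int s * r + int (Suc v)" "v < s" using season_decomposition[OF s] .
  have "state causal_solution t \<omega> i
      = rec.path_sum (int (Suc v)) (\<lambda>x. eta (x + int s * r) \<omega>) i"
    using block_index_less[OF t(2) i] t i p
    by (simp add: state_eq causal_solution_def period_sum_def del: of_nat_Suc)
  also have "\<dots> = rec.path_sum t (\<lambda>r. eta r \<omega>) i"
    using path_sum_shift[of "int (Suc v)" "\<lambda>r. eta r \<omega>" r i]
    by (simp only: t(1) add.commute[of "int (Suc v)"])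
  finally show ?thesis .
qed

lemma causal_solution_ergodic: "ergodic_process M (vec_borel ((p + q) * s)) causal_solution"
  unfolding causal_solution_def[abs_def]
proof (rule factor_of_iid_ergodic[where E = borel and D = "distr M borel (eta 0)"])
  have ident: "distr M borel (eta t) = distr M borel (eta 0)" for t
  proof -
    have "distr M borel (eta t) = distr (distr M borel (eps t)) borel (\<lambda>x. x\<^sup>2)" for t
      by (subst distr_distr) (auto simp: eta_def[abs_def] comp_def eps_measurable)
    from this[of t] this[of 0] show ?thesis by (simp only: eps_ident[of t])
  qed
  have "distr M (Pi\<^sub>M UNIV (\<lambda>_. borel)) (\<lambda>\<omega>. \<lambda>t\<in>UNIV. eta t \<omega>)
      = Pi\<^sub>M UNIV (\<lambda>t. distr M borel (eta t))"
    using eta_indep by (subst (asm) indep_vars_iff_distr_eq_PiM) (auto intro: eta_measurable)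
  also have "Pi\<^sub>M UNIV (\<lambda>t. distr M borel (eta t)) = Pi\<^sub>M UNIV (\<lambda>_. distr M borel (eta 0))"
    by (intro PiM_cong refl ident)
  finally show "distr M (Pi\<^sub>M UNIV (\<lambda>_. borel)) (\<lambda>\<omega> t. eta t \<omega>)
      = Pi\<^sub>M UNIV (\<lambda>_. distr M borel (eta 0))"
    by (simp add: restrict_UNIV)
  show "prob_space (distr M borel (eta 0))" by (rule prob_space_distr[OF eta_measurable])
qed (use s in \<open>auto intro: prob_space_axioms eta_measurable period_sum_measurable\<close>)

text \<open>The value at period \<open>t\<close> uses the noise up to the end of that period only, and this part of the
  noise path can be read off from the vectors \<open>eta_vec s eps (t - k)\<close>.\<close>

lemma causal_solution_causal: "causal_process M s ((p + q) * s) eps causal_solution"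
proof -
  \<comment> \<open>rebuilds the noise up to time \<open>s\<close> from the vectors of the present and past periods; later values
    do not matter and are set to 0\<close>
  define noise :: "(nat \<Rightarrow> real Matrix.vec) \<Rightarrow> int \<Rightarrow> real" where
    "noise g r = (if r \<le> int s then g (nat (- ((r - 1) div int s))) $ nat ((r - 1) mod int s) else 0)"
    for g r
  have noise: "noise \<in> Pi\<^sub>M UNIV (\<lambda>_. vec_borel s) \<rightarrow>\<^sub>M Pi\<^sub>M UNIV (\<lambda>_. borel)"
  proof -
    have "(\<lambda>g. noise g r) \<in> borel_measurable (Pi\<^sub>M UNIV (\<lambda>_. vec_borel s))" for r
    proof (cases "r \<le> int s")
      case True
      have "nat ((r - 1) mod int s) < s" using s by (simp add: nat_less_iff)
      then have "(\<lambda>g. g (nat (- ((r - 1) div int s))) $ nat ((r - 1) mod int s))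
          \<in> borel_measurable (Pi\<^sub>M UNIV (\<lambda>_. vec_borel s))"
        by (intro measurable_compose[where f = "\<lambda>g. g (nat (- ((r - 1) div int s)))"
              and g = "\<lambda>x. x $ nat ((r - 1) mod int s)" and N = "vec_borel s"]
            measurable_component_singleton measurable_vec_borel_component) auto
      then show ?thesis using True by (simp add: noise_def)
    qed (simp add: noise_def)
    then show ?thesis by (rule measurable_PiM_UNIV[of "\<lambda>r g. noise g r" _ "\<lambda>_. borel"])
  qed
  have "causal_solution t \<omega> = period_sum (noise (\<lambda>k. eta_vec s eps (t - int k) \<omega>))" for t \<omega>
  proof -
    let ?e = "\<lambda>r. eta (r + int s * t) \<omega>" and ?n = "noise (\<lambda>k. eta_vec s eps (t - int k) \<omega>)"
    have eq: "?n r = ?e r" if r: "r \<le> int s" for r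
    proof -
      let ?k = "(r - 1) div int s" and ?v = "nat ((r - 1) mod int s)"
      have v: "?v < s" "int ?v = (r - 1) mod int s" using s by (auto simp: nat_less_iff)
      have "?k \<le> (int s - 1) div int s" using r s by (intro zdiv_mono1) auto
      also have "\<dots> = 0" using s by (intro div_pos_pos_trivial) auto
      finally have "?k \<le> 0" .
      then have k: "int (nat (- ?k)) = - ?k" by simp
      have "int s * (t - int (nat (- ?k))) + int (?v + 1) = r + int s * t"
      proof -
        have "int s * ?k + (r - 1) mod int s = r - 1" by simp
        then show ?thesis unfolding k of_nat_add v(2) by (simp add: algebra_simps)
      qed
      then show ?thesis using r v(1) by (simp add: noise_def eta_vec_def eta_def)
    qed
    have "rec.path_sum t' ?e i = rec.path_sum t' ?n i" if "t' \<le> int s" "i < p + q" for t' i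
      unfolding rec.path_sum_def using that eq
      by (intro suminf_cong lag_term_cong) auto
    moreover have "int (Suc (k div (p + q))) \<le> int s" "k mod (p + q) < p + q"
      if "k < (p + q) * s" for k
      using index_div_mod_less[OF that] by auto
    ultimately show ?thesis
      unfolding causal_solution_def period_sum_def by (intro eq_vecI) (auto simp del: of_nat_Suc)
  qed
  then show ?thesis
    unfolding causal_process_def
    by (intro bexI[where x = "\<lambda>g. period_sum (noise g)"] measurable_compose[OF noise period_sum_measurable])
       auto
qed

context
  assumes spectral: "spectral_radius (map_mat complex_of_real periodic.monodromy) < 1"
begin

lemma causal_solution_stationary_L1: "stationary_L1_solution M s p q alpha beta eps causal_solution"
  unfolding stationary_L1_solution_def pgarch_vector_solution_def
proof (intro conjI allI)
  note sol = rec.path_sum_solution[OF periodic.summable_of_spectral_radius[OF spectral]]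
  show "causal_solution t \<in> M \<rightarrow>\<^sub>M vec_borel ((p + q) * s)" for t
    by (rule causal_solution_measurable)
  show "strictly_stationary M (vec_borel ((p + q) * s)) causal_solution"
    using causal_solution_ergodic by (simp add: ergodic_process_def)
  have "rec.solves (state causal_solution)"
    using sol(1) by (simp add: rec.solves_def state_causal_solution)
  then show "AE \<omega> in M. causal_solution t \<omega> =
      pgarch_A s p q alpha beta (eta_vec s eps t \<omega>) *\<^sub>v causal_solution (t - 1) \<omega>
        + pgarch_B s p q alpha beta (eta_vec s eps t \<omega>)" for t
    using solves_state_iff[of causal_solution, OF causal_solution_measurable] by blast
  have component: "causal_solution t \<omega> $ k
      = rec.path_sum (int s * t + int (Suc (k div (p + q)))) (\<lambda>r. eta r \<omega>) (k mod (p + q))"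
    if k: "k < (p + q) * s" for t \<omega> k
    using state_causal_solution[OF index_div_mod_less(2)[OF k]]
      state_eq[OF index_div_mod_less(1)[OF k], of causal_solution] index_div_mod_less(3)[OF k]
    by metis
  show "AE \<omega> in M. \<forall>k<(p + q) * s. 0 \<le> causal_solution t \<omega> $ k" for t
  proof -
    have "AE \<omega> in M. \<forall>v. \<forall>i<p + q. 0 \<le> rec.path_sum (int s * t + int (Suc v)) (\<lambda>r. eta r \<omega>) i"
      using sol(3) by (simp add: AE_all_countable)
    then show ?thesis
      by eventually_elim (simp add: component index_div_mod_less(2) del: of_nat_Suc)
  qed
  show "integrable M (\<lambda>\<omega>. vec_norm (causal_solution t \<omega>))" for t
    by (rule integrable_vec_norm[OF causal_solution_measurable])
       (simp add: component sol(2) index_div_mod_less(2) del: of_nat_Suc)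
qed

lemma stationary_L1_solution_unique:
  assumes Y: "stationary_L1_solution M s p q alpha beta eps Y"
    and Y': "stationary_L1_solution M s p q alpha beta eps Y'"
  shows "AE \<omega> in M. Y' t \<omega> = Y t \<omega>"
proof -
  \<comment> \<open>constant input 1, whose lag terms are the row sums of the products of mean matrices\<close>
  interpret one: periodic_recursion s "p + q" mean_phi "\<lambda>_. Matrix.vec (p + q) (\<lambda>_. 1)"
    by unfold_locales (use periodic.s periodic.d periodic.N periodic.N_nonneg in auto)
  have decay: "(\<lambda>k. lag_term (p + q) periodic.m (\<lambda>_ _. 1) k t i) \<longlonglongrightarrow> 0" if i: "i < p + q" for t i
  proof -
    have "lag_term (p + q) periodic.m (\<lambda>_ _. 1) k t i = lag_term (p + q) periodic.m one.b k t i" for k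
      using i by (intro lag_term_cong) auto
    then show ?thesis
      using summable_LIMSEQ_zero[OF one.summable_of_spectral_radius[OF spectral i]] by simp
  qed
  obtain C1 C2 where C: "\<And>t. (\<Sum>i<p + q. \<integral>\<omega>. \<bar>state Y t \<omega> i\<bar> \<partial>M) \<le> C1"
    "\<And>t. (\<Sum>i<p + q. \<integral>\<omega>. \<bar>state Y' t \<omega> i\<bar> \<partial>M) \<le> C2"
    using state_moments_bounded[OF Y] state_moments_bounded[OF Y'] by blast
  have "AE \<omega> in M. state Y' t \<omega> i = state Y t \<omega> i" if i: "i < p + q" for t i
  proof (rule rec.solution_unique[where C = "max C1 C2"])
    show "(\<Sum>i<p + q. \<integral>\<omega>. \<bar>state Y' t \<omega> i\<bar> \<partial>M) \<le> max C1 C2"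
      "(\<Sum>i<p + q. \<integral>\<omega>. \<bar>state Y t \<omega> i\<bar> \<partial>M) \<le> max C1 C2" for t
      using C(1)[of t] C(2)[of t] by auto
  qed (use i in \<open>auto intro: state_solves Y Y' state_integrable decay\<close>)
  then have "AE \<omega> in M. \<forall>v i. i < p + q \<longrightarrow>
      state Y' (int s * t + int (Suc v)) \<omega> i = state Y (int s * t + int (Suc v)) \<omega> i"
    by (simp add: AE_all_countable)
  then show ?thesis
    using AE_space
  proof eventually_elim
    case (elim \<omega>)
    have dim: "dim_vec (Y t \<omega>) = (p + q) * s" "dim_vec (Y' t \<omega>) = (p + q) * s"
      using measurable_space[OF solution_measurable[OF Y] elim(2)]
        measurable_space[OF solution_measurable[OF Y'] elim(2)] by auto
    have "Y' t \<omega> $ k = Y t \<omega> $ k" if k: "k < (p + q) * s" for k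
      using elim(1)[rule_format, OF index_div_mod_less(2)[OF k], of "k div (p + q)"]
      unfolding state_eq[OF index_div_mod_less(1)[OF k]] index_div_mod_less(3)[OF k] .
    with dim show ?case by (intro eq_vecI) auto
  qed
qed

end

end

theorem theorem3:
  fixes M :: "'a measure"
    and s p q :: nat
    and alpha beta :: "nat \<Rightarrow> nat \<Rightarrow> real"
    and eps :: "int \<Rightarrow> 'a \<Rightarrow> real"
  assumes prob: "prob_space M"
    and "1 \<le> s" and "1 \<le> p" and "1 \<le> q"
    and alpha0_pos: "\<And>v. v \<in> {1..s} \<Longrightarrow> 0 < alpha 0 v"
    and alpha_nonneg: "\<And>i v. i \<in> {1..p} \<Longrightarrow> v \<in> {1..s} \<Longrightarrow> 0 \<le> alpha i v"
    and beta_nonneg: "\<And>j v. j \<in> {1..q} \<Longrightarrow> v \<in> {1..s} \<Longrightarrow> 0 \<le> beta j v"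
    and eps_indep: "prob_space.indep_vars M (\<lambda>_. borel) eps UNIV"
    and eps_ident: "\<And>t. distr M borel (eps t) = distr M borel (eps 0)"
    and eps_integrable: "\<And>t. integrable M (\<lambda>\<omega>. (eps t \<omega>) ^ 3)"
    and eps_mean: "\<And>t. (\<integral>\<omega>. eps t \<omega> \<partial>M) = 0"
    and eps_moment2: "\<And>t. (\<integral>\<omega>. (eps t \<omega>) ^ 2 \<partial>M) = 1"
    and eps_moment3: "\<And>t. (\<integral>\<omega>. (eps t \<omega>) ^ 3 \<partial>M) = 0"
  shows "((\<exists>Y. unique_stationary_L1_solution M s p q alpha beta eps Y) \<longleftrightarrow>
          spectral_radius (map_mat complex_of_real
            (mat_prod (p + q) (\<lambda>v. pgarch_mean_phi M s p q alpha beta eps (s - v)) s)) < 1) \<and>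
         (\<forall>Y. unique_stationary_L1_solution M s p q alpha beta eps Y \<longrightarrow>
            causal_process M s ((p + q) * s) eps Y \<and>
            ergodic_process M (vec_borel ((p + q) * s)) Y)"
proof -
  interpret pgarch M s p q alpha beta eps
    using assms by (simp add: pgarch_def pgarch_axioms_def)
  let ?rho = "spectral_radius (map_mat complex_of_real periodic.monodromy)"
  have necessary: "?rho < 1" if "unique_stationary_L1_solution M s p q alpha beta eps Y" for Y
    using that spectral_radius_of_solution unfolding unique_stationary_L1_solution_def by blast
  have sufficient: "unique_stationary_L1_solution M s p q alpha beta eps causal_solution" if "?rho < 1"
    using causal_solution_stationary_L1[OF that] stationary_L1_solution_unique[OF that]
    unfolding unique_stationary_L1_solution_def by blast
  have "causal_process M s ((p + q) * s) eps Y \<and> ergodic_process M (vec_borel ((p + q) * s)) Y"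
    if Y: "unique_stationary_L1_solution M s p q alpha beta eps Y" for Y
  proof
    have sol: "stationary_L1_solution M s p q alpha beta eps Y"
      using Y by (simp add: unique_stationary_L1_solution_def)
    have eq: "AE \<omega> in M. Y t \<omega> = causal_solution t \<omega>" for t
      using sufficient[OF necessary[OF Y]] sol unfolding unique_stationary_L1_solution_def by blast
    obtain f where f: "f \<in> Pi\<^sub>M UNIV (\<lambda>_. vec_borel s) \<rightarrow>\<^sub>M vec_borel ((p + q) * s)"
      "\<And>t. AE \<omega> in M. causal_solution t \<omega> = f (\<lambda>k. eta_vec s eps (t - int k) \<omega>)"
      using causal_solution_causal unfolding causal_process_def by blast
    have "AE \<omega> in M. Y t \<omega> = f (\<lambda>k. eta_vec s eps (t - int k) \<omega>)" for t
      using eq[of t] f(2)[of t] by eventually_elim simp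
    with f(1) show "causal_process M s ((p + q) * s) eps Y"
      unfolding causal_process_def by blast
    show "ergodic_process M (vec_borel ((p + q) * s)) Y"
      using sol by (intro ergodic_process_AE_eq[OF prob causal_solution_ergodic _ causal_solution_measurable
            solution_measurable[OF sol] eq]) (simp add: stationary_L1_solution_def)
  qed
  with necessary sufficient show ?thesis unfolding monodromy_eq by blast
qed

end
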